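(* Over $\mathbb{F}_4$, in $\mathbb{F}_4^5$, there exist multispreads with parameters $(51,5)_4^{3,5}$, $(36,6)_4^{3,5}$ and $(21,7)_4^{3,5}$ whose full automorphism groups have order $120$, $40$ and $7$, respectively. More precisely, there exist multisets of subspaces of $\mathbb{F}_4^5$ consisting of, respectively, (a) $17$ two-dimensional and $65$ three-dimensional subspaces, with full automorphism group of order $120$, (b) $12$ two-dimensional and $86$ three-dimensional subspaces, with full automorphism group of order $40$, (c) $7$ two-dimensional and $107$ three-dimensional subspaces, with full automorphism group of order $7$, such that in each case every hyperplane of $\mathbb{F}_4^5$ contains exactly $2$ of the subspaces (counted with multiplicity); these are multispreads with the parameters $(51,5)_4^{3,5}$, $(36,6)_4^{3,5}$, $(21,7)_4^{3,5}$, respectively.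
   Context: All dimensions are vector-space dimensions; a hyperplane of $\mathbb{F}_q^k$ is a $(k-1)$-dimensional subspace. A $(\lambda,\mu)_q^{h,k}$-multispread is a collection (multiset) $\mathcal{S}$ of subspaces of $\mathbb{F}_q^k$ of dimension at most $h$ such that $\sum_{S\in\mathcal{S},\,v\in S}q^{h-\dim S}=\mu$ for every non-zero vector $v\in\mathbb{F}_q^k$, and $\sum_{S\in\mathcal{S}}(q^{h-\dim S}-1)=\lambda$. The full automorphism group of a multiset $\mathcal{S}$ of subspaces of $\mathbb{F}_q^k$ is the group of all collineations of the projective geometry of $\mathbb{F}_q^k$ (invertible semilinear maps of $\mathbb{F}_q^k$, taken modulo non-zero scalars) that map $\mathcal{S}$ to itself, preserving multiplicities. *)

theory Defs
  imports "HOL-Analysis.Analysis" "HOL-Algebra.Coset" "HOL-Library.Multiset" "HOL-Library.Z2"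
begin

section \<open>The field with four elements\<close>

text \<open>\<open>GF4 a b\<close> stands for \<open>a + b * w\<close> in the quotient of the polynomial ring over \<^typ>\<open>bit\<close>
  by \<open>w^2 + w + 1\<close>.  The inverse of a non-zero element is its conjugate, all norms
  of non-zero elements being 1.\<close>

datatype gf4 = GF4 bit bit

instantiation gf4 :: field
begin

definition zero_gf4 :: gf4 where "(0::gf4) = GF4 0 0"

definition one_gf4 :: gf4 where "1 = GF4 1 0"

fun plus_gf4 :: "gf4 \<Rightarrow> gf4 \<Rightarrow> gf4" where
  "GF4 a b + GF4 c d = GF4 (a + c) (b + d)"

definition uminus_gf4 :: "gf4 \<Rightarrow> gf4" where "- x = (x::gf4)"

definition minus_gf4 :: "gf4 \<Rightarrow> gf4 \<Rightarrow> gf4" where "x - y = x + (y::gf4)"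

fun times_gf4 :: "gf4 \<Rightarrow> gf4 \<Rightarrow> gf4" where
  "GF4 a b * GF4 c d = GF4 (a * c + b * d) (a * d + b * c + b * d)"

fun inverse_gf4 :: "gf4 \<Rightarrow> gf4" where
  "inverse (GF4 a b) = GF4 (a + b) b"

definition divide_gf4 :: "gf4 \<Rightarrow> gf4 \<Rightarrow> gf4" where "x div y = x * inverse (y::gf4)"

instance
proof
  fix x y z :: gf4
  obtain a b c d e f where [simp]: "x = GF4 a b" "y = GF4 c d" "z = GF4 e f"
    by (metis gf4.exhaust)
  note defs = zero_gf4_def one_gf4_def uminus_gf4_def minus_gf4_def divide_gf4_def
  show "x * y * z = x * (y * z)"
    by (cases a; cases b; cases c; cases d; cases e; cases f) simp_all
  show "x * y = y * x" by (cases a; cases b; cases c; cases d) simp_all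
  show "1 * x = x" by (simp add: defs)
  show "x + y + z = x + (y + z)"
    by (cases a; cases b; cases c; cases d; cases e; cases f) simp_all
  show "x + y = y + x" by (cases a; cases b; cases c; cases d) simp_all
  show "0 + x = x" by (simp add: defs)
  show "- x + x = 0" by (cases a; cases b) (simp_all add: defs)
  show "x - y = x + - y" by (simp add: defs)
  show "(x + y) * z = x * z + y * z"
    by (cases a; cases b; cases c; cases d; cases e; cases f) simp_all
  show "(0::gf4) \<noteq> 1" by (simp add: defs)
  show "x \<noteq> 0 \<Longrightarrow> inverse x * x = 1" by (cases a; cases b) (simp_all add: defs)
  show "x div y = x * inverse y" by (simp add: defs)
  show "inverse (0::gf4) = 0" by (simp add: defs)
qed

end

lemma UNIV_gf4: "(UNIV :: gf4 set) = {GF4 0 0, GF4 1 0, GF4 0 1, GF4 1 1}"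
proof -
  have "x \<in> {GF4 0 0, GF4 1 0, GF4 0 1, GF4 1 1}" for x
  proof (cases x)
    case (GF4 a b)
    then show ?thesis by (cases a; cases b) simp_all
  qed
  then show ?thesis by blast
qed

instance gf4 :: finite
  by standard (simp add: UNIV_gf4)

lemma card_gf4: "CARD(gf4) = 4"
  by (simp add: UNIV_gf4)

section \<open>Multispreads and hyperplanes\<close>

text \<open>The parameters \<open>q\<close> and \<open>k\<close> are \<open>CARD('a)\<close> and \<open>CARD('n)\<close>.\<close>

definition multispread ::
    "nat \<Rightarrow> nat \<Rightarrow> nat \<Rightarrow> ('a::{field,finite} ^ 'n::finite) set multiset \<Rightarrow> bool" where
  "multispread lam mu h \<S> \<longleftrightarrow>
     (\<forall>S\<in>#\<S>. vec.subspace S \<and> vec.dim S \<le> h) \<and>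
     (\<forall>v. v \<noteq> 0 \<longrightarrow> (\<Sum>S\<in>#filter_mset (\<lambda>S. v \<in> S) \<S>. CARD('a) ^ (h - vec.dim S)) = mu) \<and>
     (\<Sum>S\<in>#\<S>. CARD('a) ^ (h - vec.dim S) - 1) = lam"

definition hyperplane :: "('a::field ^ 'n::finite) set \<Rightarrow> bool" where
  "hyperplane H \<longleftrightarrow> vec.subspace H \<and> vec.dim H = CARD('n) - 1"

section \<open>Collineations and automorphism groups\<close>

definition field_automorphism :: "('a::field \<Rightarrow> 'a) \<Rightarrow> bool" where
  "field_automorphism \<sigma> \<longleftrightarrow>
     bij \<sigma> \<and> (\<forall>a b. \<sigma> (a + b) = \<sigma> a + \<sigma> b) \<and> (\<forall>a b. \<sigma> (a * b) = \<sigma> a * \<sigma> b)"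

definition semilinear :: "('a::field ^ 'n::finite \<Rightarrow> 'a ^ 'n) \<Rightarrow> bool" where
  "semilinear f \<longleftrightarrow>
     (\<forall>x y. f (x + y) = f x + f y) \<and>
     (\<exists>\<sigma>. field_automorphism \<sigma> \<and> (\<forall>c x. f (c *s x) = \<sigma> c *s f x))"

definition GammaL :: "('a::field ^ 'n::finite \<Rightarrow> 'a ^ 'n) monoid" where
  "GammaL = \<lparr>carrier = {f. bij f \<and> semilinear f}, mult = (\<circ>), one = id\<rparr>"

definition scalar_maps :: "('a::field ^ 'n::finite \<Rightarrow> 'a ^ 'n) set" where
  "scalar_maps = {(\<lambda>x. c *s x) | c. c \<noteq> 0}"

definition PGammaL :: "('a::field ^ 'n::finite \<Rightarrow> 'a ^ 'n) set monoid" where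
  "PGammaL = GammaL Mod scalar_maps"

text \<open>A collineation is a coset of the group of scalar maps; on subspaces all of its
  representatives act in the same way.\<close>

definition aut_group ::
    "('a::field ^ 'n::finite) set multiset \<Rightarrow> ('a ^ 'n \<Rightarrow> 'a ^ 'n) set monoid" where
  "aut_group \<S> = PGammaL
     \<lparr>carrier := {C \<in> carrier PGammaL. \<forall>f\<in>C. image_mset (\<lambda>S. f ` S) \<S> = \<S>}\<rparr>"

lemma field_automorphism_id: "field_automorphism id"
  by (simp add: field_automorphism_def)

lemma field_automorphism_comp:
  "field_automorphism \<sigma> \<Longrightarrow> field_automorphism \<tau> \<Longrightarrow> field_automorphism (\<sigma> \<circ> \<tau>)"
  by (auto simp: field_automorphism_def bij_comp)

lemma field_automorphism_inv:
  assumes "field_automorphism \<sigma>"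
  shows "field_automorphism (inv_into UNIV \<sigma>)"
proof -
  have b: "bij \<sigma>" using assms by (simp add: field_automorphism_def)
  have s: "\<sigma> (inv_into UNIV \<sigma> x) = x" for x using b by (simp add: bij_is_surj surj_f_inv_f)
  have i: "\<sigma> x = \<sigma> y \<Longrightarrow> x = y" for x y using b by (simp add: bij_is_inj inj_eq)
  show ?thesis
    unfolding field_automorphism_def
  proof (intro conjI allI)
    show "bij (inv_into UNIV \<sigma>)" using b by (rule bij_imp_bij_inv)
    fix x y
    show "inv_into UNIV \<sigma> (x + y) = inv_into UNIV \<sigma> x + inv_into UNIV \<sigma> y"
      by (rule i) (use assms s in \<open>simp add: field_automorphism_def\<close>)
    show "inv_into UNIV \<sigma> (x * y) = inv_into UNIV \<sigma> x * inv_into UNIV \<sigma> y"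
      by (rule i) (use assms s in \<open>simp add: field_automorphism_def\<close>)
  qed
qed

lemma semilinear_comp:
  assumes "semilinear f" "semilinear g"
  shows "semilinear (f \<circ> g)"
proof -
  obtain \<sigma> where "field_automorphism \<sigma>" "\<forall>c x. f (c *s x) = \<sigma> c *s f x"
    using assms(1) unfolding semilinear_def by blast
  moreover obtain \<tau> where "field_automorphism \<tau>" "\<forall>c x. g (c *s x) = \<tau> c *s g x"
    using assms(2) unfolding semilinear_def by blast
  ultimately have "field_automorphism (\<sigma> \<circ> \<tau>)"
      "\<forall>c x. (f \<circ> g) (c *s x) = (\<sigma> \<circ> \<tau>) c *s (f \<circ> g) x"
    by (simp_all add: field_automorphism_comp)
  moreover have "\<forall>x y. (f \<circ> g) (x + y) = (f \<circ> g) x + (f \<circ> g) y"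
    using assms by (simp add: semilinear_def)
  ultimately show ?thesis unfolding semilinear_def by blast
qed

lemma semilinear_inv:
  assumes b: "bij f" and f: "semilinear f"
  shows "semilinear (inv_into UNIV f)"
proof -
  obtain \<sigma> where \<sigma>: "field_automorphism \<sigma>" "\<And>c x. f (c *s x) = \<sigma> c *s f x"
    and add: "\<And>x y. f (x + y) = f x + f y"
    using f by (auto simp: semilinear_def)
  have \<sigma>s: "\<sigma> (inv_into UNIV \<sigma> c) = c" for c
    using \<sigma>(1) by (simp add: field_automorphism_def bij_is_surj surj_f_inv_f)
  have s: "f (inv_into UNIV f x) = x" for x using b by (simp add: bij_is_surj surj_f_inv_f)
  have i: "f x = f y \<Longrightarrow> x = y" for x y using b by (simp add: bij_is_inj inj_eq)
  have "inv_into UNIV f (x + y) = inv_into UNIV f x + inv_into UNIV f y" for x y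
    by (rule i) (simp add: add s)
  moreover have "inv_into UNIV f (c *s x) = inv_into UNIV \<sigma> c *s inv_into UNIV f x" for c x
    by (rule i) (simp add: \<sigma> s \<sigma>s)
  ultimately show ?thesis
    using field_automorphism_inv[OF \<sigma>(1)] unfolding semilinear_def by blast
qed

lemma scalar_bij: "c \<noteq> 0 \<Longrightarrow> bij ((\<lambda>x. c *s x) :: 'a::field ^ 'n::finite \<Rightarrow> 'a ^ 'n)"
  by (rule o_bij[where g = "(\<lambda>x. inverse c *s x)"]) (auto simp: fun_eq_iff)

lemma scalar_semilinear: "semilinear ((\<lambda>x. c *s x) :: 'a::field ^ 'n::finite \<Rightarrow> 'a ^ 'n)"
  unfolding semilinear_def
  using field_automorphism_id
  by (auto simp: vec.scale_right_distrib mult.commute intro!: exI[of _ id])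

lemma semilinear_id: "semilinear id"
  unfolding semilinear_def using field_automorphism_id by (auto intro!: exI[of _ id])

lemma scalar_mapsI: "c \<noteq> 0 \<Longrightarrow> (\<lambda>x. c *s x) \<in> scalar_maps"
  unfolding scalar_maps_def by blast

lemma group_GammaL: "group (GammaL :: ('a::field ^ 'n::finite \<Rightarrow> 'a ^ 'n) monoid)"
proof (rule groupI)
  fix f :: "'a ^ 'n \<Rightarrow> 'a ^ 'n" assume "f \<in> carrier GammaL"
  then show "\<exists>g\<in>carrier GammaL. g \<otimes>\<^bsub>GammaL\<^esub> f = \<one>\<^bsub>GammaL\<^esub>"
    by (intro bexI[of _ "inv_into UNIV f"])
      (auto simp: GammaL_def semilinear_inv bij_imp_bij_inv bij_is_inj)
qed (auto simp: GammaL_def semilinear_comp semilinear_id bij_comp o_assoc)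

lemma inv_GammaL: "f \<in> carrier GammaL \<Longrightarrow> inv\<^bsub>GammaL\<^esub> f = inv_into UNIV f"
  by (rule group.inv_equality[OF group_GammaL])
    (auto simp: GammaL_def semilinear_inv bij_imp_bij_inv bij_is_inj)

lemma scalar_maps_normal:
  "scalar_maps \<lhd> (GammaL :: ('a::field ^ 'n::finite \<Rightarrow> 'a ^ 'n) monoid)"
proof -
  interpret group "GammaL :: ('a ^ 'n \<Rightarrow> 'a ^ 'n) monoid" by (rule group_GammaL)
  have sub: "f \<in> carrier GammaL" if "f \<in> scalar_maps" for f :: "'a ^ 'n \<Rightarrow> 'a ^ 'n"
    using that by (auto simp: scalar_maps_def GammaL_def scalar_bij scalar_semilinear)
  have "subgroup scalar_maps (GammaL :: ('a ^ 'n \<Rightarrow> 'a ^ 'n) monoid)"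
  proof
    show "scalar_maps \<subseteq> carrier (GammaL :: ('a ^ 'n \<Rightarrow> 'a ^ 'n) monoid)"
      by (rule subsetI) (rule sub)
  next
    have "\<one>\<^bsub>GammaL\<^esub> = ((\<lambda>x. 1 *s x) :: 'a ^ 'n \<Rightarrow> 'a ^ 'n)"
      by (rule ext) (simp add: GammaL_def)
    then show "\<one>\<^bsub>GammaL\<^esub> \<in> (scalar_maps :: ('a ^ 'n \<Rightarrow> 'a ^ 'n) set)"
      by (simp only: scalar_mapsI[OF one_neq_zero])
  next
    fix g h :: "'a ^ 'n \<Rightarrow> 'a ^ 'n"
    assume "g \<in> scalar_maps" "h \<in> scalar_maps"
    then obtain c d where c: "g = (\<lambda>x. c *s x)" "c \<noteq> 0" and d: "h = (\<lambda>x. d *s x)" "d \<noteq> 0"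
      unfolding scalar_maps_def by blast
    have "g \<otimes>\<^bsub>GammaL\<^esub> h = (\<lambda>x. (c * d) *s x)"
      by (rule ext) (simp add: GammaL_def c(1) d(1))
    moreover have "c * d \<noteq> 0" using c(2) d(2) by simp
    ultimately show "g \<otimes>\<^bsub>GammaL\<^esub> h \<in> scalar_maps"
      by (simp only: scalar_mapsI not_False_eq_True)
  next
    fix g :: "'a ^ 'n \<Rightarrow> 'a ^ 'n"
    assume g: "g \<in> scalar_maps"
    then obtain c where c: "g = (\<lambda>x. c *s x)" "c \<noteq> 0"
      unfolding scalar_maps_def by blast
    have h: "((\<lambda>x. inverse c *s x) :: 'a ^ 'n \<Rightarrow> 'a ^ 'n) \<in> scalar_maps"
      by (rule scalar_mapsI) (use c(2) in simp)
    have "(\<lambda>x. inverse c *s x) \<otimes>\<^bsub>GammaL\<^esub> g = \<one>\<^bsub>GammaL\<^esub>"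
      by (rule ext) (use c(2) in \<open>simp add: GammaL_def c(1)\<close>)
    from inv_equality[OF this sub[OF g] sub[OF h]]
    show "inv\<^bsub>GammaL\<^esub> g \<in> scalar_maps" using h by (simp only:)
  qed
  moreover have "f \<otimes>\<^bsub>GammaL\<^esub> g \<otimes>\<^bsub>GammaL\<^esub> inv\<^bsub>GammaL\<^esub> f \<in> scalar_maps"
    if f: "f \<in> carrier GammaL" and g: "g \<in> scalar_maps" for f g :: "'a ^ 'n \<Rightarrow> 'a ^ 'n"
  proof -
    obtain \<sigma> where \<sigma>: "field_automorphism \<sigma>" "\<And>c x. f (c *s x) = \<sigma> c *s f x"
      using f by (auto simp: GammaL_def semilinear_def)
    obtain c where c: "g = (\<lambda>x. c *s x)" "c \<noteq> 0"
      using g unfolding scalar_maps_def by blast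
    have b: "bij f" using f by (simp add: GammaL_def)
    have "\<sigma> 0 + \<sigma> 0 = \<sigma> 0"
      using \<sigma>(1) unfolding field_automorphism_def by (metis add_0_left)
    then have "\<sigma> 0 = 0" by (rule add_cancel_right_right[THEN iffD1, OF sym])
    moreover have "\<sigma> c \<noteq> \<sigma> 0"
      using c(2) \<sigma>(1) by (simp add: bij_is_inj field_automorphism_def inj_eq)
    ultimately have "\<sigma> c \<noteq> 0" by simp
    moreover have "f \<otimes>\<^bsub>GammaL\<^esub> g \<otimes>\<^bsub>GammaL\<^esub> inv\<^bsub>GammaL\<^esub> f = (\<lambda>x. \<sigma> c *s x)"
      unfolding inv_GammaL[OF f]
      by (rule ext) (simp add: GammaL_def c(1) \<sigma>(2) b bij_is_surj surj_f_inv_f)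
    ultimately show ?thesis by (simp only: scalar_mapsI not_False_eq_True)
  qed
  ultimately show ?thesis unfolding normal_inv_iff by blast
qed

lemma group_PGammaL: "group PGammaL"
  unfolding PGammaL_def by (rule normal.factorgroup_is_group[OF scalar_maps_normal])

end

(*
  Dualising, the task is to cover every point of PG(4,4) exactly twice by planes and lines.  The 17
  two-dimensional subspaces of part (a) arise from the lines of PG(5,4) that represent a conic of
  PG(2,16), by projection from a point of PG(5,4) on its nucleus.  The three-dimensional subspaces are
  orbits of the stabiliser of two of them, found by solving an exact cover problem.  Part (b) uses 12
  of the 17 subspaces and a subgroup of index 3, part (c) an orbit of a collineation of order 7.

  The order of the automorphism group is the number of permutations it induces on the two-dimensional
  subspaces L_i, because a collineation fixing all L_i fixes enough points to be trivial.  The group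
  preserves the number of three-dimensional members meeting both L_i and L_j, and the relation
  "L_d meets the intersection of the hyperplanes L_a + L_b and L_a + L_c".  A search shows that no more
  than 120, 40 and 7 permutations preserve both; explicit collineations induce that many.
*)
theory Submission
  imports Defs
begin

section \<open>Linear algebra: dual bases, hyperplanes, semilinear bijections\<close>

section \<open>Kernels of linear forms\<close>

text \<open>The three pairs of sizes solve one equation. Of the 341 hyperplanes, 21 contain a given
  two-dimensional subspace and 5 a given three-dimensional one, so x and y members of these
  dimensions need 21 x + 5 y = 682; trading 5 members of dimension two for 21 of dimension three
  leads from (17, 65) to (12, 86) and (7, 107). Counting non-zero vectors with weights 4 and 1 gives
  mu = (60 x + 63 y) / 1023 = 5, 6, 7, and lambda = 3 x. The order 120 comes from the conic:
  PGammaL(2,16), of order 16320, permutes its 17 points, and the stabiliser of one of the 136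
  unordered pairs of points has order 16320 / 136. Neither bound on the group order asks for a group
  to be computed. The search uses necessary conditions only, so the number of its survivors is an
  upper bound; the products of the generators need only be pairwise distinct to give a lower bound.
  The two counts agree in each of the three cases.\<close>

definition dotp :: "'a::field ^ 'n::finite \<Rightarrow> 'a ^ 'n \<Rightarrow> 'a" where
  "dotp h x = (\<Sum>i\<in>UNIV. h $ i * x $ i)"

lemma dotp_add_right: "dotp h (x + y) = dotp h x + dotp h y"
  by (simp add: dotp_def distrib_left sum.distrib)

lemma dotp_scale_right: "dotp h (c *s x) = c * dotp h x"
  by (simp add: dotp_def sum_distrib_left mult.left_commute)

lemma dotp_zero_right [simp]: "dotp h 0 = 0"
  by (simp add: dotp_def)

lemma dotp_scale_left: "dotp (c *s h) x = c * dotp h x"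
  by (simp add: dotp_def sum_distrib_left mult.assoc)

lemma dotp_commute: "dotp h x = dotp x h"
  by (simp add: dotp_def mult.commute)

lemma dotp_sum_right: "dotp h (\<Sum>a\<in>A. g a) = (\<Sum>a\<in>A. dotp h (g a))"
  by (induction A rule: infinite_finite_induct) (simp_all add: dotp_add_right)

lemma dotp_axis: "dotp h (axis i 1) = h $ i"
  by (simp add: dotp_def axis_def if_distrib cong: if_cong)

lemma subspace_kernel: "vec.subspace {x. dotp h x = 0}"
  by (auto simp: vec.subspace_def dotp_add_right dotp_scale_right)

text \<open>Pairing a vanishing combination with \<open>\<phi> x\<close> isolates the coefficient of
  \<open>x\<close>.\<close>

lemma independent_dual:
  fixes A :: "('a::field ^ 'n::finite) set"
  assumes "finite A" "\<And>x y. x \<in> A \<Longrightarrow> y \<in> A \<Longrightarrow> dotp (\<phi> x) y = (if x = y then 1 else 0)"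
  shows "vec.independent A"
proof (rule vec.independent_if_scalars_zero[OF assms(1)])
  fix f x assume s: "(\<Sum>x\<in>A. f x *s x) = 0" and x: "x \<in> A"
  have "0 = dotp (\<phi> x) (\<Sum>y\<in>A. f y *s y)" by (simp add: s)
  also have "\<dots> = (\<Sum>y\<in>A. if y = x then f y else 0)"
    unfolding dotp_sum_right by (rule sum.cong) (auto simp: dotp_scale_right assms(2) x)
  also have "\<dots> = f x" using assms(1) x by simp
  finally show "f x = 0" by simp
qed

text \<open>By its size the independent set \<open>A \<union> C\<close> is a basis, with dual basis
  \<open>\<phi>\<close>. A vector lies in the span of \<open>A\<close> iff its coefficients on
  \<open>C\<close> vanish, and these are its values under the forms \<open>\<phi> w\<close>.\<close>

lemma span_eq_kernels:
  fixes A C :: "('a::field ^ 'n::finite) set"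
  assumes fin: "finite (A \<union> C)" and card: "card (A \<union> C) = CARD('n)" and disj: "A \<inter> C = {}"
    and dual: "\<And>x y. x \<in> A \<union> C \<Longrightarrow> y \<in> A \<union> C \<Longrightarrow> dotp (\<phi> x) y = (if x = y then 1 else 0)"
  shows "vec.span A = {x. \<forall>w\<in>C. dotp (\<phi> w) x = 0}"
proof
  show "vec.span A \<subseteq> {x. \<forall>w\<in>C. dotp (\<phi> w) x = 0}"
  proof (rule vec.span_minimal)
    show "A \<subseteq> {x. \<forall>w\<in>C. dotp (\<phi> w) x = 0}" using dual disj by (auto simp: dual)
    show "vec.subspace {x. \<forall>w\<in>C. dotp (\<phi> w) x = 0}"
      by (auto simp: vec.subspace_def dotp_add_right dotp_scale_right)
  qed
  have "vec.independent (A \<union> C)" by (rule independent_dual[OF fin dual])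
  then have U: "UNIV \<subseteq> vec.span (A \<union> C)"
    by (intro vec.card_ge_dim_independent) (auto simp: card card_cart_basis)
  show "{x. \<forall>w\<in>C. dotp (\<phi> w) x = 0} \<subseteq> vec.span A"
  proof
    fix x assume x: "x \<in> {x. \<forall>w\<in>C. dotp (\<phi> w) x = 0}"
    have "x \<in> vec.span (A \<union> C)" using U by auto
    then obtain u where u: "x = (\<Sum>a\<in>A \<union> C. u a *s a)"
      unfolding vec.span_finite[OF fin] by auto
    have "u w = 0" if w: "w \<in> C" for w
    proof -
      have "0 = dotp (\<phi> w) x" using x w by simp
      also have "\<dots> = (\<Sum>y\<in>A \<union> C. if y = w then u y else 0)"
        unfolding u dotp_sum_right by (rule sum.cong) (use w in \<open>auto simp: dotp_scale_right dual\<close>)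
      also have "\<dots> = u w" using fin w by simp
      finally show ?thesis by simp
    qed
    then have "x = (\<Sum>a\<in>A. u a *s a)"
      unfolding u using fin disj by (subst sum.union_disjoint) auto
    then show "x \<in> vec.span A"
      by (simp add: vec.span_sum vec.span_scale vec.span_base)
  qed
qed

lemma hyperplane_kernel:
  fixes h :: "'a::field ^ 'n::finite"
  assumes "h \<noteq> 0"
  shows "hyperplane {x. dotp h x = 0}"
proof -
  let ?K = "{x. dotp h x = 0}"
  obtain i where i: "h $ i \<noteq> 0" using assms by (auto simp: vec_eq_iff)
  \<comment> \<open>On \<open>b\<close> the form takes the value 1, so subtracting
    \<open>dotp h x *s b\<close> projects any \<open>x\<close> into the kernel; the kernel thus has
    codimension 1.\<close>
  define b where "b = (inverse (h $ i)) *s (axis i 1 :: 'a ^ 'n)"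
  have b: "dotp h b = 1" using i by (simp add: b_def dotp_scale_right dotp_axis)
  have "x \<in> vec.span (insert b ?K)" for x
  proof -
    have "x = dotp h x *s b + (x - dotp h x *s b)" by simp
    moreover have "x - dotp h x *s b \<in> ?K"
      using dotp_add_right[of h "x - dotp h x *s b" "dotp h x *s b"]
      by (simp add: dotp_scale_right b)
    then have "x - dotp h x *s b \<in> vec.span (insert b ?K)" by (simp add: vec.span_base)
    moreover have "dotp h x *s b \<in> vec.span (insert b ?K)"
      by (simp add: vec.span_base vec.span_scale)
    ultimately show ?thesis by (metis vec.span_add)
  qed
  then have "vec.dim (insert b ?K) = CARD('n)"
    by (metis UNIV_eq_I vec.dim_span vec_dim_card)
  moreover have "b \<notin> vec.span ?K"
    using b by (simp add: vec.span_eq_iff[THEN iffD2, OF subspace_kernel])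
  ultimately have "vec.dim ?K + 1 = CARD('n)" by (simp add: vec.dim_insert)
  then show ?thesis unfolding hyperplane_def using subspace_kernel by auto
qed

lemma hyperplane_imp_kernel:
  fixes H :: "('a::field ^ 'n::finite) set"
  assumes "hyperplane H"
  obtains h where "h \<noteq> 0" "H = {x. dotp h x = 0}"
proof -
  have sub: "vec.subspace H" and dim: "vec.dim H = CARD('n) - 1"
    using assms by (auto simp: hyperplane_def)
  have n: "0 < CARD('n)" by simp
  obtain B where B: "B \<subseteq> H" "vec.independent B" "H \<subseteq> vec.span B" "card B = vec.dim H"
    using vec.basis_exists by blast
  have BH: "vec.span B = H" using B sub by (metis subset_antisym vec.span_minimal)
  have "H \<noteq> UNIV" using dim n by (metis diff_less less_irrefl vec_dim_card zero_less_one)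
  then obtain b where b: "b \<notin> H" by auto
  then have ind: "vec.independent (insert b B)"
    using B BH by (simp add: vec.independent_insertI)
  have nb: "b \<notin> B" using b B by auto
  have "vec.dim (insert b B) = CARD('n)"
    using ind nb B(4) dim n vec.finiteI_independent[OF B(2)] by (simp add: vec.dim_eq_card_independent)
  then have U: "vec.span (insert b B) = UNIV"
    using vec.subspace_dim_equal[of "vec.span (insert b B)" UNIV] by (simp add: card_cart_basis)
  \<comment> \<open>Any coordinate will do: the form is read off as row \<open>i\<close> of the
    matrix of an endomorphism that kills \<open>B\<close> and sends \<open>b\<close> to the unit
    vector of \<open>i\<close>.\<close>
  obtain i :: 'n where True by simp
  obtain f where f: "Vector_Spaces.linear (*s) (*s) f"
      "\<forall>x\<in>insert b B. f x = (if x = b then axis i 1 else 0 :: 'a ^ 'n)"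
    using vec.linear_independent_extend[OF ind, of "\<lambda>x. if x = b then axis i 1 else 0"] by blast
  define h where "h = matrix f $ i"
  have hf: "dotp h x = f x $ i" for x
    using matrix_works[OF f(1), of x] by (simp add: h_def dotp_def matrix_vector_mult_def vec_eq_iff)
  have hb: "dotp h b = 1" using f(2) by (simp add: hf)
  have "dotp h x = 0" if "x \<in> B" for x using f(2) that nb by (auto simp: hf)
  then have 1: "H \<subseteq> {x. dotp h x = 0}"
    unfolding BH[symmetric] by (intro vec.span_minimal subspace_kernel) auto
  have 2: "x \<in> H" if "dotp h x = 0" for x
  proof -
    have "x \<in> vec.span (insert b B)" using U by simp
    then obtain k where k: "x - k *s b \<in> vec.span B" by (auto simp: vec.span_insert)
    then have "dotp h (x - k *s b) = 0" using BH 1 by auto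
    then have "k = 0"
      using dotp_add_right[of h "x - k *s b" "k *s b"] that by (simp add: dotp_scale_right hb)
    then show ?thesis using k BH by simp
  qed
  have "h \<noteq> 0" using hb by (auto simp: dotp_def)
  then show thesis using 1 2 by (intro that[of h]) auto
qed

section \<open>Semilinear bijections\<close>

lemma field_automorphism_0 [simp]: "field_automorphism \<sigma> \<Longrightarrow> \<sigma> 0 = 0"
  unfolding field_automorphism_def by (metis add_cancel_right_right add_0)

lemma field_automorphism_1 [simp]: "field_automorphism \<sigma> \<Longrightarrow> \<sigma> 1 = 1"
  unfolding field_automorphism_def
  by (metis bij_pointE mult.right_neutral mult_cancel_left1 mult.commute)

lemma GammaL_cases:
  assumes "f \<in> carrier GammaL"
  obtains \<sigma> where "field_automorphism \<sigma>" "\<And>c x. f (c *s x) = \<sigma> c *s f x"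
    "\<And>x y. f (x + y) = f x + f y" "f 0 = 0" "bij f"
proof -
  obtain \<sigma> where \<sigma>: "field_automorphism \<sigma>" "\<And>c x. f (c *s x) = \<sigma> c *s f x"
    "\<And>x y. f (x + y) = f x + f y" "bij f"
    using assms by (auto simp: GammaL_def semilinear_def)
  moreover have "f 0 = 0" using \<sigma>(3)[of 0 0] by simp
  ultimately show thesis by (intro that)
qed

lemma GammaL_inv_into:
  "f \<in> carrier GammaL \<Longrightarrow> inv_into UNIV f \<in> carrier GammaL"
  by (auto simp: GammaL_def semilinear_inv bij_imp_bij_inv)

lemma GammaL_comp:
  "f \<in> carrier GammaL \<Longrightarrow> g \<in> carrier GammaL \<Longrightarrow> f \<circ> g \<in> carrier GammaL"
  by (auto simp: GammaL_def semilinear_comp bij_comp)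

lemma subspace_image:
  assumes f: "f \<in> carrier GammaL" and S: "vec.subspace S"
  shows "vec.subspace (f ` S)"
proof -
  obtain \<sigma> where \<sigma>: "field_automorphism \<sigma>" "\<And>c x. f (c *s x) = \<sigma> c *s f x"
    "\<And>x y. f (x + y) = f x + f y" "f 0 = 0" by (rule GammaL_cases[OF f]) blast
  have "c *s f x \<in> f ` S" if "x \<in> S" for c x
  proof -
    obtain d where "\<sigma> d = c"
      using \<sigma>(1) unfolding field_automorphism_def by (metis bij_pointE)
    then have "c *s f x = f (d *s x)" by (simp add: \<sigma>(2))
    then show ?thesis using S that by (simp add: vec.subspace_def)
  qed
  then show ?thesis using S \<sigma>(3,4) unfolding vec.subspace_def
    by (auto simp: image_iff) metis+
qed

lemma image_inv_into: "bij f \<Longrightarrow> inv_into UNIV f ` (f ` S) = S"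
  by (simp add: bij_is_inj image_image)

text \<open>The image of a subspace is a subspace, so minimality of the span gives one inclusion;
  the other is the same inclusion applied to the inverse map.\<close>

lemma span_image:
  fixes f :: "'a::field ^ 'n::finite \<Rightarrow> 'a ^ 'n"
  assumes f: "f \<in> carrier GammaL"
  shows "f ` vec.span A = vec.span (f ` A)"
proof -
  have *: "vec.span (g ` A) \<subseteq> g ` vec.span A"
    if g: "g \<in> carrier GammaL" for g :: "'a ^ 'n \<Rightarrow> 'a ^ 'n" and A
    by (rule vec.span_minimal) (use vec.span_superset in \<open>auto simp: subspace_image[OF g]\<close>)
  have b: "bij f" using f by (simp add: GammaL_def)
  have "vec.span A \<subseteq> inv_into UNIV f ` vec.span (f ` A)"
    using *[OF GammaL_inv_into[OF f], of "f ` A"] by (simp add: image_inv_into[OF b])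
  then have "f ` vec.span A \<subseteq> f ` (inv_into UNIV f ` vec.span (f ` A))" by (rule image_mono)
  also have "\<dots> = vec.span (f ` A)"
    using b by (simp add: image_image bij_is_surj surj_f_inv_f)
  finally show ?thesis using *[OF f] by blast
qed

lemma dim_image:
  fixes f :: "'a::field ^ 'n::finite \<Rightarrow> 'a ^ 'n"
  assumes f: "f \<in> carrier GammaL"
  shows "vec.dim (f ` S) = vec.dim S"
proof -
  have *: "vec.dim (g ` S) \<le> vec.dim S"
    if g: "g \<in> carrier GammaL" for g :: "'a ^ 'n \<Rightarrow> 'a ^ 'n" and S
  proof -
    obtain B where B: "B \<subseteq> S" "vec.independent B" "S \<subseteq> vec.span B" "card B = vec.dim S"
      using vec.basis_exists by blast
    then have fin: "finite B" by (simp add: vec.finiteI_independent)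
    have "g ` S \<subseteq> vec.span (g ` B)" using B(3) by (auto simp: span_image[OF g, symmetric])
    then have "vec.dim (g ` S) \<le> card (g ` B)" using fin by (intro vec.dim_le_card) auto
    also have "\<dots> \<le> vec.dim S" using fin B(4) card_image_le by metis
    finally show ?thesis .
  qed
  have b: "bij f" using f by (simp add: GammaL_def)
  show ?thesis
    using *[OF f, of S] *[OF GammaL_inv_into[OF f], of "f ` S"] by (simp add: image_inv_into[OF b])
qed

lemma hyperplane_image:
  "f \<in> carrier GammaL \<Longrightarrow> hyperplane (f ` H) \<longleftrightarrow> hyperplane H"
proof -
  assume f: "f \<in> carrier GammaL"
  then have "bij f" by (simp add: GammaL_def)
  then show ?thesis
    using subspace_image[OF f, of H] subspace_image[OF GammaL_inv_into[OF f], of "f ` H"]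
    by (auto simp: hyperplane_def dim_image[OF f] image_inv_into)
qed

section \<open>A model of \<open>gf4 ^ 5\<close> that can be evaluated\<close>

section \<open>Computing with coordinate vectors over the field with four elements\<close>

text \<open>The elements 0, 1, w and w + 1 = w^2 as bare constructors: field operations become
  tables of rewrite rules, and the checks below reduce to pattern matching.\<close>

datatype q4 = Z | I | W | U

datatype vec5 = V q4 q4 q4 q4 q4

fun emb :: "q4 \<Rightarrow> gf4" where
  "emb Z = GF4 0 0"
| "emb I = GF4 1 0"
| "emb W = GF4 0 1"
| "emb U = GF4 1 1"

fun qadd :: "q4 \<Rightarrow> q4 \<Rightarrow> q4" where
  "qadd Z y = y"
| "qadd I Z = I" | "qadd I I = Z" | "qadd I W = U" | "qadd I U = W"
| "qadd W Z = W" | "qadd W I = U" | "qadd W W = Z" | "qadd W U = I"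
| "qadd U Z = U" | "qadd U I = W" | "qadd U W = I" | "qadd U U = Z"

fun qmul :: "q4 \<Rightarrow> q4 \<Rightarrow> q4" where
  "qmul Z y = Z"
| "qmul I y = y"
| "qmul W Z = Z" | "qmul W I = W" | "qmul W W = U" | "qmul W U = I"
| "qmul U Z = Z" | "qmul U I = U" | "qmul U W = I" | "qmul U U = W"

fun qfrob :: "bool \<Rightarrow> q4 \<Rightarrow> q4" where
  "qfrob False x = x"
| "qfrob True Z = Z" | "qfrob True I = I" | "qfrob True W = U" | "qfrob True U = W"

fun toV :: "vec5 \<Rightarrow> gf4 ^ 5" where
  "toV (V a b c d e) = (\<chi> i. if i = 1 then emb a else if i = 2 then emb b else
     if i = 3 then emb c else if i = 4 then emb d else emb e)"

fun vadd :: "vec5 \<Rightarrow> vec5 \<Rightarrow> vec5" where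
  "vadd (V a b c d e) (V a' b' c' d' e') = V (qadd a a') (qadd b b') (qadd c c') (qadd d d') (qadd e e')"

fun vscale :: "q4 \<Rightarrow> vec5 \<Rightarrow> vec5" where
  "vscale k (V a b c d e) = V (qmul k a) (qmul k b) (qmul k c) (qmul k d) (qmul k e)"

fun dt :: "vec5 \<Rightarrow> vec5 \<Rightarrow> q4" where
  "dt (V a b c d e) (V a' b' c' d' e') =
     qadd (qmul a a') (qadd (qmul b b') (qadd (qmul c c') (qadd (qmul d d') (qmul e e'))))"

lemma exhaust_5: "x = 1 \<or> x = 2 \<or> x = 3 \<or> x = 4 \<or> x = 5" for x :: 5
proof (induct x)
  case (of_int z)
  then have "z = 0 \<or> z = 1 \<or> z = 2 \<or> z = 3 \<or> z = 4" by fastforce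
  then show ?case by auto
qed

lemma UNIV_5: "(UNIV :: 5 set) = {1, 2, 3, 4, 5}"
proof -
  have "x \<in> {1, 2, 3, 4, 5}" for x :: 5 using exhaust_5[of x] by simp
  then show ?thesis by blast
qed

lemma sum_5: "(\<Sum>i\<in>(UNIV :: 5 set). f i) = f 1 + (f 2 + (f 3 + (f 4 + f 5)))"
  unfolding UNIV_5 by simp

lemma emb_qadd: "emb (qadd x y) = emb x + emb y"
  by (cases x; cases y) simp_all

lemma emb_qmul: "emb (qmul x y) = emb x * emb y"
  by (cases x; cases y) simp_all

lemma emb_Z: "emb Z = 0" and emb_I: "emb I = 1"
  by (simp_all add: zero_gf4_def one_gf4_def)

lemma emb_inject [simp]: "emb x = emb y \<longleftrightarrow> x = y"
  by (cases x; cases y) simp_all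

lemma emb_surj: obtains y where "x = emb y"
proof (cases x)
  case (GF4 a b)
  then have "x = emb (if a = 0 then (if b = 0 then Z else W) else (if b = 0 then I else U))"
    by (cases a; cases b) simp_all
  then show thesis by (rule that)
qed

lemma emb_eq_0 [simp]: "emb x = 0 \<longleftrightarrow> x = Z" and emb_eq_1 [simp]: "emb x = 1 \<longleftrightarrow> x = I"
  using emb_inject[of x Z] emb_inject[of x I] by (simp_all only: emb_Z emb_I)

declare emb.simps [simp del]

lemma toV_surj: obtains v where "x = toV v"
proof -
  obtain a b c d e where "x $ 1 = emb a" "x $ 2 = emb b" "x $ 3 = emb c" "x $ 4 = emb d" "x $ 5 = emb e"
    by (metis emb_surj)
  then have "x = toV (V a b c d e)"
    by (simp add: vec_eq_iff) (metis exhaust_5)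
  then show thesis by (rule that)
qed

lemma toV_inject [simp]: "toV u = toV v \<longleftrightarrow> u = v"
proof (cases u; cases v)
  fix a b c d e a' b' c' d' e'
  assume [simp]: "u = V a b c d e" "v = V a' b' c' d' e'"
  have "u = v" if "toV u = toV v"
  proof -
    have "toV u $ i = toV v $ i" for i using that by simp
    from this[of 1] this[of 2] this[of 3] this[of 4] this[of 5] show ?thesis by simp
  qed
  then show ?thesis by blast
qed

lemma toV_vadd: "toV (vadd u v) = toV u + toV v"
  by (cases u; cases v) (simp add: vec_eq_iff emb_qadd)

lemma toV_vscale: "toV (vscale k v) = emb k *s toV v"
  by (cases v) (simp add: vec_eq_iff emb_qmul)

lemma toV_zero [simp]: "toV (V Z Z Z Z Z) = 0"
  by (simp add: vec_eq_iff emb_Z)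

lemma toV_eq_0: "toV v = 0 \<longleftrightarrow> v = V Z Z Z Z Z"
  using toV_inject[of v "V Z Z Z Z Z"] by (simp only: toV_zero)

declare toV.simps [simp del]

lemma dotp_toV: "dotp (toV u) (toV v) = emb (dt u v)"
  by (cases u; cases v) (simp add: dotp_def sum_5 emb_qadd emb_qmul toV.simps)

lemma dt_commute: "dt u v = dt v u"
  using dotp_commute[of "toV u" "toV v"] by (simp add: dotp_toV)

section \<open>Representatives of the points\<close>

definition scalars :: "q4 list" where "scalars = [Z, I, W, U]"

text \<open>Vectors whose first non-zero coordinate is 1: 256 + 64 + 16 + 4 + 1 = 341 of them. The
  list serves twice, for points and, through normal vectors, for hyperplanes.\<close>

definition points :: "vec5 list" where
  "points = [V I b c d e. b \<leftarrow> scalars, c \<leftarrow> scalars, d \<leftarrow> scalars, e \<leftarrow> scalars]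
     @ [V Z I c d e. c \<leftarrow> scalars, d \<leftarrow> scalars, e \<leftarrow> scalars]
     @ [V Z Z I d e. d \<leftarrow> scalars, e \<leftarrow> scalars] @ [V Z Z Z I e. e \<leftarrow> scalars] @ [V Z Z Z Z I]"

lemma set_scalars: "set scalars = UNIV"
  by (auto simp: scalars_def) (metis q4.exhaust)

lemma in_points [simp]:
  "V I b c d e \<in> set points" "V Z I c d e \<in> set points" "V Z Z I d e \<in> set points"
  "V Z Z Z I e \<in> set points" "V Z Z Z Z I \<in> set points"
  by (auto simp: points_def set_scalars image_iff)

lemma points_cover:
  assumes "x \<noteq> 0"
  obtains c p where "c \<noteq> 0" "p \<in> set points" "x = c *s toV p"
proof -
  \<comment> \<open>Inversion, with \<open>Z\<close> sent to itself; \<open>W\<close> and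
    \<open>U\<close> are exchanged because w * (w + 1) = 1.\<close>
  define qinv where "qinv k = (case k of W \<Rightarrow> U | U \<Rightarrow> W | j \<Rightarrow> j)" for k
  have inv: "qmul (qinv k) k = I" "qmul k (qmul (qinv k) l) = l" "qmul k Z = Z" if "k \<noteq> Z" for k l
    using that by (cases k; cases l; simp add: qinv_def)+
  obtain v where v: "x = toV v" by (rule toV_surj)
  have "\<exists>k. k \<noteq> Z \<and> vscale (qinv k) v \<in> set points"
  proof (cases v)
    case (V a b c d e)
    have "v \<noteq> V Z Z Z Z Z" using assms v by (auto)
    then consider "a \<noteq> Z" | "a = Z" "b \<noteq> Z" | "a = Z" "b = Z" "c \<noteq> Z" | "a = Z" "b = Z" "c = Z" "d \<noteq> Z"
      | "a = Z" "b = Z" "c = Z" "d = Z" "e \<noteq> Z" using V by blast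
    moreover have Z: "qmul k Z = Z" for k by (cases k) simp_all
    ultimately show ?thesis
    proof cases
      case 1 then show ?thesis by (intro exI[of _ a]) (simp add: V inv)
    next
      case 2 then show ?thesis by (intro exI[of _ b]) (simp add: V inv Z)
    next
      case 3 then show ?thesis by (intro exI[of _ c]) (simp add: V inv Z)
    next
      case 4 then show ?thesis by (intro exI[of _ d]) (simp add: V inv Z)
    next
      case 5 then show ?thesis by (intro exI[of _ e]) (simp add: V inv Z)
    qed
  qed
  then obtain k where k: "k \<noteq> Z" "vscale (qinv k) v \<in> set points" by blast
  have "x = emb k *s toV (vscale (qinv k) v)"
    using k(1) inv(2)[of k] by (cases v) (simp add: v vec_eq_iff toV.simps flip: emb_qmul)
  then show thesis using k by (intro that) auto
qed

lemma points_nonzero: "p \<in> set points \<Longrightarrow> toV p \<noteq> 0"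
  by (auto simp: points_def toV_eq_0)

lemma hyperplane_iff: "hyperplane H \<longleftrightarrow> (\<exists>p\<in>set points. H = {x. dotp (toV p) x = 0})"
proof
  assume "hyperplane H"
  then obtain h where h: "h \<noteq> 0" "H = {x. dotp h x = 0}" by (rule hyperplane_imp_kernel)
  from h(1) obtain c p where "c \<noteq> 0" "p \<in> set points" "h = c *s toV p" by (rule points_cover)
  then show "\<exists>p\<in>set points. H = {x. dotp (toV p) x = 0}"
    using h(2) by (auto simp: dotp_scale_left)
next
  show "hyperplane H" if "\<exists>p\<in>set points. H = {x. dotp (toV p) x = 0}"
    using that hyperplane_kernel points_nonzero by blast
qed

section \<open>Subspaces given by generators\<close>

text \<open>A basis \<open>gs\<close> in reduced row echelon form is completed by the unit vectors at the non-pivot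
  columns; the unit vectors at the pivot columns together with the rows of \<open>ann gs\<close> are the dual basis.\<close>

definition units :: "vec5 list" where
  "units = [V I Z Z Z Z, V Z I Z Z Z, V Z Z I Z Z, V Z Z Z I Z, V Z Z Z Z I]"

fun lead :: "vec5 \<Rightarrow> vec5" where
  "lead (V a b c d e) =
     (case a of Z \<Rightarrow> case b of Z \<Rightarrow> case c of Z \<Rightarrow> case d of Z \<Rightarrow> V Z Z Z Z I
        | _ \<Rightarrow> V Z Z Z I Z | _ \<Rightarrow> V Z Z I Z Z | _ \<Rightarrow> V Z I Z Z Z | _ \<Rightarrow> V I Z Z Z Z)"

text \<open>The result is \<open>e\<close> plus the sum of \<open>dt g e\<close> times the pivot
  unit vector of \<open>g\<close>. For an echelon basis its product with each row \<open>g\<close>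
  is \<open>dt g e + dt g e\<close>, which vanishes in characteristic 2.\<close>

fun annrow :: "vec5 list \<Rightarrow> vec5 \<Rightarrow> vec5" where
  "annrow [] e = e"
| "annrow (g # gs) e = vadd (vscale (dt g e) (lead g)) (annrow gs e)"

definition free :: "vec5 list \<Rightarrow> vec5 list" where
  "free gs = fold removeAll (map lead gs) units"

definition ann :: "vec5 list \<Rightarrow> vec5 list" where
  "ann gs = map (annrow gs) (free gs)"

text \<open>Instead of the echelon form itself, the check demands what is used of it: the pairing
  table between the candidate dual basis and the completed basis is the identity. This certifies
  independence and defining equations at once.\<close>

definition good :: "vec5 list \<Rightarrow> bool" where
  "good gs \<longleftrightarrow> (let bs = gs @ free gs in length (free gs) + length gs = 5 \<and>
     map (\<lambda>f. map (dt f) bs) (map lead gs @ ann gs) =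
       [[I, Z, Z, Z, Z], [Z, I, Z, Z, Z], [Z, Z, I, Z, Z], [Z, Z, Z, I, Z], [Z, Z, Z, Z, I]])"

text \<open>A conditional replaces the conjunction, here and in later checks, so that evaluation by
  rewriting stops at the first failing test.\<close>

fun perp :: "vec5 \<Rightarrow> vec5 list \<Rightarrow> bool" where
  "perp h [] \<longleftrightarrow> True"
| "perp h (g # gs) \<longleftrightarrow> (if dt h g = Z then perp h gs else False)"

definition sp :: "vec5 list \<Rightarrow> (gf4 ^ 5) set" where
  "sp gs = vec.span (toV ` set gs)"

lemma perp_iff: "perp h gs \<longleftrightarrow> (\<forall>g\<in>set gs. dt h g = Z)"
  by (induction gs) auto

lemma subspace_sp [simp]: "vec.subspace (sp gs)"
  by (simp add: sp_def)

text \<open>Turns the identity table, which is indexed by list positions, into a dual family indexed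
  by vectors, the form needed by \<open>span_eq_kernels\<close>.\<close>

lemma good_dual:
  assumes "good gs"
  defines "A \<equiv> toV ` set gs" and "C \<equiv> toV ` set (free gs)"
  shows "\<exists>\<phi>. (\<forall>x\<in>A \<union> C. \<forall>y\<in>A \<union> C. dotp (\<phi> x) y = (if x = y then 1 else 0)) \<and>
    \<phi> ` C = toV ` set (ann gs)" "A \<inter> C = {}" "card A = length gs" "card (A \<union> C) = 5"
proof -
  define bs where "bs = gs @ free gs"
  define fs where "fs = map lead gs @ ann gs"
  have lb: "length bs = 5" and lf: "length fs = 5"
    using assms(1) by (auto simp: good_def bs_def fs_def Let_def ann_def)
  have m: "map (\<lambda>f. map (dt f) bs) fs =
      [[I, Z, Z, Z, Z], [Z, I, Z, Z, Z], [Z, Z, I, Z, Z], [Z, Z, Z, I, Z], [Z, Z, Z, Z, I]]"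
    using assms(1) by (simp add: good_def bs_def fs_def Let_def)
  have dt: "dt (fs ! i) (bs ! j) = (if i = j then I else Z)" if "i < 5" "j < 5" for i j
  proof -
    have "dt (fs ! i) (bs ! j) = map (\<lambda>f. map (dt f) bs) fs ! i ! j"
      using that lb lf by simp
    also have "\<dots> = (if i = j then I else Z)"
      unfolding m using that by (auto simp: less_Suc_eq numeral_eq_Suc)
    finally show ?thesis .
  qed
  \<comment> \<open>A repetition in \<open>bs\<close> would give two equal columns of the identity
    table, one with \<open>I\<close> and one with \<open>Z\<close> in the same row.\<close>
  have dist: "distinct bs"
    unfolding distinct_conv_nth lb using dt by (metis q4.distinct(1))
  define \<phi> where "\<phi> x = toV (fs ! (THE i. i < 5 \<and> toV (bs ! i) = x))" for x
  have idx: "\<phi> (toV (bs ! i)) = toV (fs ! i)" if "i < 5" for i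
  proof -
    have "(THE j. j < 5 \<and> toV (bs ! j) = toV (bs ! i)) = i"
      using that dist lb by (auto simp: nth_eq_iff_index_eq)
    then show ?thesis by (simp add: \<phi>_def)
  qed
  have free: "free gs = map (\<lambda>i. bs ! i) [length gs..<5]"
    using lb by (intro nth_equalityI) (auto simp: bs_def nth_append)
  have ann: "ann gs = map (\<lambda>i. fs ! i) [length gs..<5]"
    using lf by (intro nth_equalityI) (auto simp: fs_def nth_append)
  have 1: "dotp (\<phi> x) y = (if x = y then 1 else 0)"
    if "x \<in> toV ` set bs" "y \<in> toV ` set bs" for x y
  proof -
    obtain i j where ij: "i < 5" "j < 5" "x = toV (bs ! i)" "y = toV (bs ! j)"
      using \<open>x \<in> _\<close> \<open>y \<in> _\<close> lb by (auto simp: in_set_conv_nth)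
    then show ?thesis
      using dist lb by (auto simp: idx dotp_toV dt nth_eq_iff_index_eq emb_Z emb_I)
  qed
  have 2: "\<phi> ` toV ` set (free gs) = toV ` set (ann gs)"
    unfolding free ann using idx by (force simp: image_iff)
  have inj: "inj_on toV X" for X by (auto simp: inj_on_def)
  have AC: "A \<union> C = toV ` set bs" by (simp add: A_def C_def bs_def image_Un)
  show "card (A \<union> C) = 5"
    unfolding AC using dist lb by (simp only: card_image[OF inj] distinct_card)
  show "A \<inter> C = {}" "card A = length gs"
    using dist by (auto simp: A_def C_def bs_def card_image[OF inj] distinct_card)
  show "\<exists>\<phi>. (\<forall>x\<in>A \<union> C. \<forall>y\<in>A \<union> C. dotp (\<phi> x) y = (if x = y then 1 else 0)) \<and>
    \<phi> ` C = toV ` set (ann gs)"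
    unfolding AC using 1 2 by (intro exI[of _ \<phi>]) (simp add: C_def)
qed

text \<open>The rows of \<open>ann gs\<close> are the dual forms of the completing unit vectors,
  hence equations for the span of \<open>gs\<close>.\<close>

lemma good_sp:
  assumes "good gs"
  shows "toV v \<in> sp gs \<longleftrightarrow> perp v (ann gs)" "vec.dim (sp gs) = length gs"
proof -
  let ?A = "toV ` set gs" and ?C = "toV ` set (free gs)"
  note AC = good_dual(2,3,4)[OF assms]
  obtain \<phi> where
    \<phi>: "\<forall>x\<in>?A \<union> ?C. \<forall>y\<in>?A \<union> ?C. dotp (\<phi> x) y = (if x = y then 1 else 0)"
    "\<phi> ` ?C = toV ` set (ann gs)"
    using good_dual(1)[OF assms] by blast
  have "sp gs = {x. \<forall>w\<in>?C. dotp (\<phi> w) x = 0}"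
    unfolding sp_def by (rule span_eq_kernels[OF _ _ AC(1)]) (use \<phi>(1) in \<open>simp_all add: AC(3)\<close>)
  also have "\<dots> = {x. \<forall>h\<in>\<phi> ` ?C. dotp h x = 0}" by simp
  finally have "sp gs = {x. \<forall>h\<in>set (ann gs). dotp (toV h) x = 0}" unfolding \<phi>(2) by simp
  then show "toV v \<in> sp gs \<longleftrightarrow> perp v (ann gs)"
    by (simp add: perp_iff dotp_toV dt_commute[of v])
  have "vec.independent ?A"
    by (rule independent_dual[of _ \<phi>]) (use \<phi>(1) in simp_all)
  then show "vec.dim (sp gs) = length gs"
    by (simp add: sp_def vec.dim_eq_card_independent AC(2))
qed

lemma in_sp: "g \<in> set gs \<Longrightarrow> toV g \<in> sp gs"
  by (simp add: sp_def vec.span_base)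

lemma sp_subset_iff:
  assumes "vec.subspace T"
  shows "sp gs \<subseteq> T \<longleftrightarrow> (\<forall>g\<in>set gs. toV g \<in> T)"
proof
  assume "\<forall>g\<in>set gs. toV g \<in> T"
  then have "toV ` set gs \<subseteq> T" by auto
  then show "sp gs \<subseteq> T" unfolding sp_def using assms by (rule vec.span_minimal)
qed (auto intro: in_sp)

lemma sp_subset_kernel: "sp gs \<subseteq> {x. dotp (toV h) x = 0} \<longleftrightarrow> perp h gs"
  by (simp add: sp_subset_iff[OF subspace_kernel] perp_iff dotp_toV )

section \<open>From the quotient group to a count of permutations, and invariants of
  automorphisms\<close>

section \<open>The order of the automorphism group\<close>

text \<open>The preimage of the automorphism group in \<open>GammaL\<close>, scalar maps included;
  working with maps avoids carrying cosets through the argument.\<close>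

definition automs :: "('a::field ^ 'n::finite) set multiset \<Rightarrow> ('a ^ 'n \<Rightarrow> 'a ^ 'n) set" where
  "automs \<S> = {f \<in> carrier GammaL. image_mset ((`) f) \<S> = \<S>}"

lemma automs_GammaL: "f \<in> automs \<S> \<Longrightarrow> f \<in> carrier GammaL"
  by (simp add: automs_def)

lemma automs_comp:
  assumes "f \<in> automs \<S>" "g \<in> automs \<S>"
  shows "f \<circ> g \<in> automs \<S>"
proof -
  have "(`) (f \<circ> g) = (`) f \<circ> (`) g" by (simp add: fun_eq_iff image_comp)
  then have "image_mset ((`) (f \<circ> g)) \<S> = image_mset ((`) f) (image_mset ((`) g) \<S>)"
    by (simp add: multiset.map_comp)
  then show ?thesis using assms by (simp add: automs_def GammaL_comp)
qed

lemma automs_id: "id \<in> automs \<S>"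
  by (simp add: automs_def GammaL_def semilinear_id)

lemma automs_inv:
  assumes "f \<in> automs \<S>"
  shows "inv_into UNIV f \<in> automs \<S>"
proof -
  have f: "f \<in> carrier GammaL" and S: "image_mset ((`) f) \<S> = \<S>"
    using assms by (auto simp: automs_def)
  have b: "bij f" using f by (simp add: GammaL_def)
  have "image_mset ((`) (inv_into UNIV f)) \<S> = image_mset ((`) (inv_into UNIV f)) (image_mset ((`) f) \<S>)"
    by (simp add: S)
  also have "\<dots> = \<S>" by (simp add: multiset.map_comp comp_def image_inv_into[OF b])
  finally show ?thesis by (simp add: automs_def GammaL_inv_into f)
qed

lemma scalar_image:
  assumes "c \<noteq> 0" "vec.subspace S"
  shows "(\<lambda>x. c *s x) ` S = S"
proof
  show "(\<lambda>x. c *s x) ` S \<subseteq> S" using assms by (auto simp: vec.subspace_def)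
  show "S \<subseteq> (\<lambda>x. c *s x) ` S"
  proof
    fix x assume "x \<in> S"
    then have "inverse c *s x \<in> S" "x = c *s (inverse c *s x)"
      using assms by (auto simp: vec.subspace_def)
    then show "x \<in> (\<lambda>x. c *s x) ` S" by blast
  qed
qed

lemma bex_scalar_maps: "(\<exists>h\<in>scalar_maps. P h) \<longleftrightarrow> (\<exists>c. c \<noteq> 0 \<and> P (\<lambda>x. c *s x))"
  unfolding scalar_maps_def by blast

lemma card_image_eq:
  assumes "\<And>x y. x \<in> A \<Longrightarrow> y \<in> A \<Longrightarrow> f x = f y \<longleftrightarrow> g x = g y"
  shows "card (f ` A) = card (g ` A)"
proof -
  define h where "h z = g (SOME x. x \<in> A \<and> f x = z)" for z
  have h: "h (f x) = g x" if "x \<in> A" for x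
  proof -
    have "(SOME y. y \<in> A \<and> f y = f x) \<in> A \<and> f (SOME y. y \<in> A \<and> f y = f x) = f x"
      by (rule someI[of _ x]) (simp add: that)
    then show ?thesis unfolding h_def using assms that by blast
  qed
  then have "inj_on h (f ` A)" using assms by (auto simp: inj_on_def)
  then have "card (h ` f ` A) = card (f ` A)" by (rule card_image)
  moreover have "h ` f ` A = g ` A" using h by (auto simp: image_iff)
  ultimately show ?thesis by simp
qed

text \<open>If two automorphisms \<open>f\<close> and \<open>g\<close> act alike on
  \<open>Xs\<close>, then \<open>g\<close> inverse after \<open>f\<close> fixes every member of
  \<open>Xs\<close> and is a scalar map by faithfulness, so both represent the same collineation.
  Conversely scalars fix all subspaces. Cosets and image lists therefore correspond one to
  one.\<close>

lemma order_aut_group: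
  fixes \<S> :: "('a::field ^ 'n::finite) set multiset"
  assumes sub: "\<And>S. S \<in># \<S> \<Longrightarrow> vec.subspace S"
    and subX: "\<And>X. X \<in> set Xs \<Longrightarrow> vec.subspace X"
    and faithful: "\<And>f. f \<in> automs \<S> \<Longrightarrow> (\<And>X. X \<in> set Xs \<Longrightarrow> f ` X = X) \<Longrightarrow> f \<in> scalar_maps"
  shows "order (aut_group \<S>) = card ((\<lambda>f. map ((`) f) Xs) ` automs \<S>)"
proof -
  let ?G = "GammaL :: ('a ^ 'n \<Rightarrow> 'a ^ 'n) monoid"
  interpret G: group ?G by (rule group_GammaL)
  interpret N: normal scalar_maps ?G by (rule scalar_maps_normal)
  define C where "C f = scalar_maps #>\<^bsub>?G\<^esub> f" for f
  have C: "g \<in> C f \<longleftrightarrow> (\<exists>c. c \<noteq> 0 \<and> g = (\<lambda>x. c *s f x))" for f g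
  proof -
    have "g \<in> C f \<longleftrightarrow> (\<exists>h\<in>scalar_maps. g = h \<otimes>\<^bsub>?G\<^esub> f)"
      by (simp add: C_def r_coset_def)
    also have "\<dots> \<longleftrightarrow> (\<exists>c. c \<noteq> 0 \<and> g = (\<lambda>x. c *s x) \<otimes>\<^bsub>?G\<^esub> f)"
      by (rule bex_scalar_maps)
    also have "\<dots> \<longleftrightarrow> (\<exists>c. c \<noteq> 0 \<and> g = (\<lambda>x. c *s f x))"
      by (simp add: GammaL_def comp_def)
    finally show ?thesis .
  qed
  have self: "f \<in> C f" for f unfolding C by (intro exI[of _ 1]) simp
  have img: "g ` S = f ` S" if "g \<in> C f" "f \<in> carrier ?G" "vec.subspace S" for f g S
  proof -
    from that(1)[unfolded C] obtain c where "c \<noteq> 0 \<and> g = (\<lambda>x. c *s f x)" ..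
    then have c: "c \<noteq> 0" "g = (\<lambda>x. c *s f x)" by simp_all
    have "g ` S = (\<lambda>x. c *s x) ` (f ` S)" unfolding c(2) image_image ..
    also have "\<dots> = f ` S" by (rule scalar_image[OF c(1) subspace_image[OF that(2,3)]])
    finally show ?thesis .
  qed
  \<comment> \<open>The definition of \<open>aut_group\<close> quantifies over the whole coset; as
    its members act alike on subspaces, one representative decides.\<close>
  have 1: "(\<forall>g\<in>C f. image_mset ((`) g) \<S> = \<S>) \<longleftrightarrow> image_mset ((`) f) \<S> = \<S>"
    if f: "f \<in> carrier ?G" for f
  proof -
    have "image_mset ((`) g) \<S> = image_mset ((`) f) \<S>" if "g \<in> C f" for g
      by (rule image_mset_cong) (rule img[OF that f sub])
    then show ?thesis using self[of f] by metis
  qed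
  have 2: "carrier (PGammaL :: ('a ^ 'n \<Rightarrow> 'a ^ 'n) set monoid) = C ` carrier ?G"
    by (auto simp: PGammaL_def FactGroup_def RCOSETS_def C_def)
  have "carrier (aut_group \<S>) = {X \<in> C ` carrier ?G. \<forall>g\<in>X. image_mset ((`) g) \<S> = \<S>}"
    unfolding aut_group_def 2 by simp
  also have "\<dots> = C ` automs \<S>"
    using 1 unfolding automs_def by blast
  finally have 3: "carrier (aut_group \<S>) = C ` automs \<S>" .
  have "C f = C g \<longleftrightarrow> map ((`) f) Xs = map ((`) g) Xs"
    if f: "f \<in> automs \<S>" and g: "g \<in> automs \<S>" for f g
  proof
    assume "C f = C g"
    then have "f \<in> C g" using self[of f] by simp
    from img[OF this automs_GammaL[OF g] subX]
    show "map ((`) f) Xs = map ((`) g) Xs" by simp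
  next
    assume eq: "map ((`) f) Xs = map ((`) g) Xs"
    have bg: "bij g" using automs_GammaL[OF g] by (simp add: GammaL_def)
    have "inv_into UNIV g \<circ> f \<in> scalar_maps"
    proof (rule faithful)
      show "inv_into UNIV g \<circ> f \<in> automs \<S>" by (intro automs_comp automs_inv f g)
      fix X assume "X \<in> set Xs"
      then have "f ` X = g ` X" using eq by simp
      then have "inv_into UNIV g ` (f ` X) = X" by (simp only: image_inv_into[OF bg])
      then show "(inv_into UNIV g \<circ> f) ` X = X" by (simp only: image_comp)
    qed
    from this[unfolded scalar_maps_def mem_Collect_eq]
    obtain c where "inv_into UNIV g \<circ> f = (\<lambda>x. c *s x) \<and> c \<noteq> 0" ..
    then have c: "c \<noteq> 0" "inv_into UNIV g \<circ> f = (\<lambda>x. c *s x)" by simp_all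
    obtain \<sigma> where \<sigma>: "field_automorphism \<sigma>" "\<And>c x. g (c *s x) = \<sigma> c *s g x"
      by (rule GammaL_cases[OF automs_GammaL[OF g]]) blast
    have "f = g \<circ> (inv_into UNIV g \<circ> f)"
      using bg by (simp add: fun_eq_iff bij_is_surj surj_f_inv_f)
    \<comment> \<open>A scalar on the right of \<open>g\<close> moves to the left as its image under
      \<sigma>.\<close>
    then have "f = (\<lambda>x. \<sigma> c *s g x)" unfolding c(2) by (simp add: comp_def \<sigma>(2))
    moreover have "\<sigma> c \<noteq> 0"
      using c(1) \<sigma>(1) field_automorphism_0[OF \<sigma>(1)]
      by (metis bij_is_inj field_automorphism_def inj_eq)
    ultimately have "\<exists>c. c \<noteq> 0 \<and> f = (\<lambda>x. c *s g x)" by (intro exI[of _ "\<sigma> c"] conjI)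
    then have "f \<in> C g" by (simp only: C)
    then show "C f = C g"
      unfolding C_def using G.repr_independence[OF _ automs_GammaL[OF g] N.subgroup_axioms] by simp
  qed
  then have "card (C ` automs \<S>) = card ((\<lambda>f. map ((`) f) Xs) ` automs \<S>)"
    by (rule card_image_eq)
  then show ?thesis unfolding order_def 3 .
qed

section \<open>Invariants\<close>

definition n2 :: "('a::field ^ 'n::finite) set multiset \<Rightarrow> ('a ^ 'n) set \<Rightarrow> ('a ^ 'n) set \<Rightarrow> nat" where
  "n2 \<S> A B = size (filter_mset (\<lambda>S. vec.dim S = 3 \<and> S \<inter> A \<noteq> {0} \<and> S \<inter> B \<noteq> {0}) \<S>)"

text \<open>Refines \<open>n2\<close> from lines to points: it can tell apart the points of a single
  line.\<close>

definition n3 :: "('a::field ^ 'n::finite) set multiset \<Rightarrow> 'a ^ 'n \<Rightarrow> ('a ^ 'n) set \<Rightarrow> nat" where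
  "n3 \<S> x A = size (filter_mset (\<lambda>S. vec.dim S = 3 \<and> x \<in> S \<and> S \<inter> A \<noteq> {0}) \<S>)"

text \<open>For subspaces this is \<open>A + B\<close>. The description by hyperplanes is visibly
  invariant, and when \<open>A + B\<close> is a hyperplane it is given by a single normal
  vector.\<close>

definition joint :: "('a::field ^ 'n::finite) set \<Rightarrow> ('a ^ 'n) set \<Rightarrow> ('a ^ 'n) set" where
  "joint A B = \<Inter>{H. hyperplane H \<and> A \<subseteq> H \<and> B \<subseteq> H}"

definition concurrent ::
  "('a::field ^ 'n::finite) set \<Rightarrow> ('a ^ 'n) set \<Rightarrow> ('a ^ 'n) set \<Rightarrow> ('a ^ 'n) set \<Rightarrow> bool" where
  "concurrent A B C D \<longleftrightarrow> joint A B \<inter> joint A C \<inter> D \<noteq> {0}"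

lemma image_eq_zero_iff:
  assumes "f \<in> carrier GammaL"
  shows "f ` S = {0} \<longleftrightarrow> S = {0}"
proof -
  have b: "bij f" and z: "f 0 = 0" using GammaL_cases[OF assms] by metis+
  have "f ` S = f ` {0} \<longleftrightarrow> S = {0}" by (rule inj_image_eq_iff[OF bij_is_inj[OF b]])
  then show ?thesis by (simp add: z)
qed

lemma size_filter_automs:
  assumes "f \<in> automs \<S>"
  shows "size (filter_mset P \<S>) = size (filter_mset (\<lambda>S. P (f ` S)) \<S>)"
proof -
  have "filter_mset P \<S> = filter_mset P (image_mset ((`) f) \<S>)"
    using assms by (simp add: automs_def)
  then show ?thesis by (simp add: filter_mset_image_mset)
qed

lemma n2_image:
  assumes f: "f \<in> automs \<S>"
  shows "n2 \<S> (f ` A) (f ` B) = n2 \<S> A B"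
proof -
  note G = automs_GammaL[OF f]
  then have inj: "inj f" by (simp add: GammaL_def bij_is_inj)
  show ?thesis
    unfolding n2_def size_filter_automs[OF f, of "\<lambda>S. vec.dim S = 3 \<and> S \<inter> f ` A \<noteq> {0} \<and> S \<inter> f ` B \<noteq> {0}"]
    by (simp add: dim_image[OF G] image_Int[OF inj, symmetric] image_eq_zero_iff[OF G])
qed

lemma n3_image:
  assumes f: "f \<in> automs \<S>"
  shows "n3 \<S> (f x) (f ` A) = n3 \<S> x A"
proof -
  note G = automs_GammaL[OF f]
  then have inj: "inj f" by (simp add: GammaL_def bij_is_inj)
  show ?thesis
    unfolding n3_def size_filter_automs[OF f, of "\<lambda>S. vec.dim S = 3 \<and> f x \<in> S \<and> S \<inter> f ` A \<noteq> {0}"]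
    by (simp add: dim_image[OF G] image_Int[OF inj, symmetric] image_eq_zero_iff[OF G]
        inj_image_mem_iff[OF inj])
qed

lemma n3_scale:
  assumes "c \<noteq> 0" "\<And>S. S \<in># \<S> \<Longrightarrow> vec.subspace S"
  shows "n3 \<S> (c *s x) A = n3 \<S> x A"
proof -
  have "c *s x \<in> S \<longleftrightarrow> x \<in> S" if "S \<in># \<S>" for S
    using vec.subspace_scale[OF assms(2)[OF that], of x c]
      vec.subspace_scale[OF assms(2)[OF that], of "c *s x" "inverse c"] assms(1) by auto
  then show ?thesis unfolding n3_def by (intro arg_cong[where f = size] filter_mset_cong) simp_all
qed

lemma joint_image:
  assumes f: "f \<in> carrier GammaL"
  shows "joint (f ` A) (f ` B) = f ` joint A B"
proof -
  have b: "bij f" using f by (simp add: GammaL_def)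
  have inj: "inj f" and surj: "surj f" using b by (auto simp: bij_is_inj bij_is_surj)
  have "f x \<in> joint (f ` A) (f ` B) \<longleftrightarrow> x \<in> joint A B" for x
  proof
    assume x: "f x \<in> joint (f ` A) (f ` B)"
    show "x \<in> joint A B"
      unfolding joint_def
    proof safe
      fix H assume "hyperplane H" "A \<subseteq> H" "B \<subseteq> H"
      then have "f x \<in> f ` H"
        using x hyperplane_image[OF f, of H] unfolding joint_def by blast
      then show "x \<in> H" using inj_image_mem_iff[OF inj] by simp
    qed
  next
    assume x: "x \<in> joint A B"
    show "f x \<in> joint (f ` A) (f ` B)"
      unfolding joint_def
    proof safe
      fix K assume K: "hyperplane K" "f ` A \<subseteq> K" "f ` B \<subseteq> K"
      have "f ` (f -` K) = K" using surj by (rule surj_image_vimage_eq)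
      then have "hyperplane (f -` K)" using K(1) hyperplane_image[OF f, of "f -` K"] by simp
      then show "f x \<in> K" using x K(2,3) unfolding joint_def by blast
    qed
  qed
  then have "f -` joint (f ` A) (f ` B) = joint A B" by auto
  then show ?thesis using surj_image_vimage_eq[OF surj] by metis
qed

lemma concurrent_image:
  assumes f: "f \<in> carrier GammaL"
  shows "concurrent (f ` A) (f ` B) (f ` C) (f ` D) \<longleftrightarrow> concurrent A B C D"
proof -
  have inj: "inj f" using f by (simp add: GammaL_def bij_is_inj)
  show ?thesis
    by (simp add: concurrent_def joint_image[OF f] image_Int[OF inj, symmetric] image_eq_zero_iff[OF f])
qed

section \<open>Designs given by lists of bases\<close>

definition design :: "vec5 list list \<Rightarrow> vec5 list list \<Rightarrow> (gf4 ^ 5) set multiset" where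
  "design Xs As = mset (map sp Xs) + mset (map sp As)"

fun valid :: "nat \<Rightarrow> vec5 list list \<Rightarrow> bool" where
  "valid k [] \<longleftrightarrow> True"
| "valid k (gs # ss) \<longleftrightarrow> (if length gs = k then if good gs then valid k ss else False else False)"

fun cnt :: "vec5 \<Rightarrow> vec5 list list \<Rightarrow> nat \<Rightarrow> nat" where
  "cnt h [] n = n"
| "cnt h (s # ss) n = cnt h ss (if perp h s then Suc n else n)"

definition hyp_check :: "vec5 list list \<Rightarrow> vec5 list list \<Rightarrow> vec5 \<Rightarrow> bool" where
  "hyp_check Xs As h \<longleftrightarrow> cnt h Xs (cnt h As 0) = 2"

text \<open>The weights are 4^(3 - 2) and 4^(3 - 3). \<open>XA\<close> and \<open>AA\<close> hold
  annihilators, so the counter that tests containment in a hyperplane for \<open>hyp_check\<close>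
  here tests membership of the point \<open>v\<close>.\<close>

definition pt_check :: "nat \<Rightarrow> vec5 list list \<Rightarrow> vec5 list list \<Rightarrow> vec5 \<Rightarrow> bool" where
  "pt_check mu XA AA v \<longleftrightarrow> 4 * cnt v XA 0 + cnt v AA 0 = mu"

lemma valid_iff: "valid k ss \<longleftrightarrow> (\<forall>gs\<in>set ss. good gs \<and> length gs = k)"
  by (induction ss) auto

lemma cnt_eq: "cnt h ss n = n + length (filter (perp h) ss)"
  by (induction ss arbitrary: n) auto

lemma design_subspace: "S \<in># design Xs As \<Longrightarrow> vec.subspace S"
  by (auto simp: design_def)

lemma size_filter_sp: "size (filter_mset P (mset (map sp ss))) = length (filter (\<lambda>gs. P (sp gs)) ss)"
  by (induction ss) auto

lemma sum_filter_sp: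
  fixes f :: "(gf4 ^ 5) set \<Rightarrow> nat"
  assumes "\<And>gs. gs \<in> set ss \<Longrightarrow> f (sp gs) = k"
  shows "(\<Sum>S\<in>#filter_mset P (mset (map sp ss)). f S) = k * length (filter (\<lambda>gs. P (sp gs)) ss)"
  using assms by (induction ss) auto

lemma filter_dim:
  assumes "valid k ss"
  shows "filter (\<lambda>gs. vec.dim (sp gs) = j) ss = (if j = k then ss else [])"
  using assms by (induction ss) (auto simp: good_sp(2) split: if_splits)

text \<open>Both incidence conditions are unchanged when a normal vector or a point is scaled, so
  the 341 representatives suffice. For the last parameter, a member of dimension 2 contributes 4 - 1
  = 3 and one of dimension 3 contributes 0.\<close>

theorem design_spec:
  assumes X: "valid 2 Xs" and A: "valid 3 As"
    and hyp: "list_all (hyp_check Xs As) points"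
    and pt: "list_all (pt_check mu (map ann Xs) (map ann As)) points"
  defines "D \<equiv> design Xs As"
  shows "\<forall>S\<in>#D. vec.subspace S \<and> vec.dim S \<in> {2, 3}"
    "size (filter_mset (\<lambda>S. vec.dim S = 2) D) = length Xs"
    "size (filter_mset (\<lambda>S. vec.dim S = 3) D) = length As"
    "\<forall>H. hyperplane H \<longrightarrow> size (filter_mset (\<lambda>S. S \<subseteq> H) D) = 2"
    "multispread (3 * length Xs) mu 3 D"
proof -
  have gX: "good gs" "length gs = 2" if "gs \<in> set Xs" for gs using X that by (auto simp: valid_iff)
  have gA: "good gs" "length gs = 3" if "gs \<in> set As" for gs using A that by (auto simp: valid_iff)
  have dX: "vec.dim (sp gs) = 2" if "gs \<in> set Xs" for gs
    using good_sp(2)[OF gX(1)[OF that]] gX(2)[OF that] by simp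
  have dA: "vec.dim (sp gs) = 3" if "gs \<in> set As" for gs
    using good_sp(2)[OF gA(1)[OF that]] gA(2)[OF that] by simp
  show dim: "\<forall>S\<in>#D. vec.subspace S \<and> vec.dim S \<in> {2, 3}"
    using dX dA by (auto simp: D_def design_def)
  show "size (filter_mset (\<lambda>S. vec.dim S = 2) D) = length Xs"
    "size (filter_mset (\<lambda>S. vec.dim S = 3) D) = length As"
    unfolding D_def design_def filter_union_mset size_union size_filter_sp
      filter_dim[OF X] filter_dim[OF A] by simp_all
  show "\<forall>H. hyperplane H \<longrightarrow> size (filter_mset (\<lambda>S. S \<subseteq> H) D) = 2"
  proof (intro allI impI)
    fix H :: "(gf4 ^ 5) set" assume "hyperplane H"
    then obtain p where p: "p \<in> set points" "H = {x. dotp (toV p) x = 0}"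
      unfolding hyperplane_iff by blast
    have "hyp_check Xs As p" using hyp p(1) by (simp add: list_all_iff)
    then show "size (filter_mset (\<lambda>S. S \<subseteq> H) D) = 2"
      unfolding D_def design_def filter_union_mset size_union size_filter_sp p(2) sp_subset_kernel
      by (simp add: hyp_check_def cnt_eq)
  qed
  show "multispread (3 * length Xs) mu 3 D"
    unfolding multispread_def card_gf4
  proof (intro conjI allI impI)
    show "\<forall>S\<in>#D. vec.subspace S \<and> vec.dim S \<le> 3" using dim by auto
    show "(\<Sum>S\<in>#D. 4 ^ (3 - vec.dim S) - 1) = 3 * length Xs"
      using sum_filter_sp[of Xs "\<lambda>S. 4 ^ (3 - vec.dim S) - 1" 3 "\<lambda>_. True"]
        sum_filter_sp[of As "\<lambda>S. 4 ^ (3 - vec.dim S) - 1" 0 "\<lambda>_. True"] dX dA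
      by (simp add: D_def design_def)
    fix v :: "gf4 ^ 5" assume "v \<noteq> 0"
    then obtain c p where c: "c \<noteq> 0" "p \<in> set points" "v = c *s toV p" by (rule points_cover)
    have mem: "v \<in> sp gs \<longleftrightarrow> perp p (ann gs)" if "good gs" for gs
    proof -
      have "v \<in> sp gs \<longleftrightarrow> toV p \<in> sp gs"
        using c(1) vec.subspace_scale[OF subspace_sp, of "toV p" gs c]
          vec.subspace_scale[OF subspace_sp, of v gs "inverse c"] by (auto simp: c(3))
      then show ?thesis by (simp add: good_sp(1)[OF that])
    qed
    have "pt_check mu (map ann Xs) (map ann As) p" using pt c(2) by (simp add: list_all_iff)
    then have "4 * length (filter (\<lambda>gs. perp p (ann gs)) Xs) + length (filter (\<lambda>gs. perp p (ann gs)) As) = mu"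
      by (simp add: pt_check_def cnt_eq filter_map comp_def)
    moreover have "filter (\<lambda>gs. v \<in> sp gs) Xs = filter (\<lambda>gs. perp p (ann gs)) Xs"
      "filter (\<lambda>gs. v \<in> sp gs) As = filter (\<lambda>gs. perp p (ann gs)) As"
      using mem gX(1) gA(1) by (auto intro: filter_cong)
    moreover have "(\<Sum>S\<in>#filter_mset (\<lambda>S. v \<in> S) (mset (map sp Xs)). 4 ^ (3 - vec.dim S)) =
        4 * length (filter (\<lambda>gs. v \<in> sp gs) Xs)"
      by (rule sum_filter_sp) (simp add: dX)
    moreover have "(\<Sum>S\<in>#filter_mset (\<lambda>S. v \<in> S) (mset (map sp As)). 4 ^ (3 - vec.dim S)) =
        1 * length (filter (\<lambda>gs. v \<in> sp gs) As)"
      by (rule sum_filter_sp) (simp add: dA)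
    ultimately show "(\<Sum>S\<in>#filter_mset (\<lambda>S. v \<in> S) D. 4 ^ (3 - vec.dim S)) = mu"
      by (simp add: D_def design_def)
  qed
qed

section \<open>Lower bound for the group order: explicit collineations\<close>

section \<open>Collineations given by matrices\<close>

text \<open>Five columns, the images of the unit vectors, and a flag telling whether squaring, the
  Frobenius automorphism, is applied to the coordinates beforehand.\<close>

type_synonym matrix5 = "vec5 \<times> vec5 \<times> vec5 \<times> vec5 \<times> vec5 \<times> bool"

definition frob :: "bool \<Rightarrow> gf4 \<Rightarrow> gf4" where
  "frob s x = (if s then x * x else x)"

fun collin :: "matrix5 \<Rightarrow> gf4 ^ 5 \<Rightarrow> gf4 ^ 5" where
  "collin (c1, c2, c3, c4, c5, s) x = frob s (x $ 1) *s toV c1 + frob s (x $ 2) *s toV c2 +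
     frob s (x $ 3) *s toV c3 + frob s (x $ 4) *s toV c4 + frob s (x $ 5) *s toV c5"

fun app :: "matrix5 \<Rightarrow> vec5 \<Rightarrow> vec5" where
  "app (c1, c2, c3, c4, c5, s) (V a b c d e) =
     vadd (vadd (vadd (vadd (vscale (qfrob s a) c1) (vscale (qfrob s b) c2)) (vscale (qfrob s c) c3))
       (vscale (qfrob s d) c4)) (vscale (qfrob s e) c5)"

definition nonzero_image :: "matrix5 \<Rightarrow> vec5 \<Rightarrow> bool" where
  "nonzero_image m p \<longleftrightarrow> (if app m p = V Z Z Z Z Z then False else True)"

lemma emb_qfrob: "emb (qfrob s x) = frob s (emb x)"
  by (cases s; cases x) (simp_all add: frob_def emb.simps zero_gf4_def one_gf4_def)

lemma collin_toV: "collin m (toV v) = toV (app m v)"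
proof -
  have "toV (V a b c d e) $ 1 = emb a" "toV (V a b c d e) $ 2 = emb b" "toV (V a b c d e) $ 3 = emb c"
    "toV (V a b c d e) $ 4 = emb d" "toV (V a b c d e) $ 5 = emb e" for a b c d e
    by (simp_all add: toV.simps)
  then show ?thesis by (cases m; cases v) (simp add: toV_vadd toV_vscale emb_qfrob)
qed

lemma gf4_add_self: "x + x = (0 :: gf4)"
  by (cases x) (simp add: zero_gf4_def)

lemma frob_frob: "frob s (frob s x) = x"
  by (cases x) (auto simp: frob_def zero_gf4_def one_gf4_def split: bit.split)

lemma field_automorphism_frob: "field_automorphism (frob s)"
  unfolding field_automorphism_def
proof (intro conjI allI)
  show "bij (frob s)" by (rule o_bij[of "frob s"]) (simp_all add: fun_eq_iff frob_frob)
  show "frob s (a + b) = frob s a + frob s b" for a b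
    using gf4_add_self[of "a * b"] by (simp add: frob_def algebra_simps)
  show "frob s (a * b) = frob s a * frob s b" for a b by (simp add: frob_def ac_simps)
qed

text \<open>No representative of a point is sent to 0, so by semilinearity no non-zero vector is; an
  additive map with trivial kernel on a finite space is bijective.\<close>

lemma collin_GammaL:
  assumes "list_all (nonzero_image m) points"
  shows "collin m \<in> carrier GammaL"
proof -
  obtain c1 c2 c3 c4 c5 s where m: "m = (c1, c2, c3, c4, c5, s)" by (cases m) auto
  note fa = field_automorphism_frob[of s]
  then have add: "frob s (a + b) = frob s a + frob s b" and mul: "frob s (a * b) = frob s a * frob s b" for a b
    by (auto simp: field_automorphism_def)
  have cadd: "collin m (x + y) = collin m x + collin m y" for x y
    by (simp add: m add vec.scale_left_distrib)
  have csc: "collin m (c *s x) = frob s c *s collin m x" for c x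
    by (simp add: m mul vec.scale_right_distrib)
  have "x = 0" if "collin m x = 0" for x
  proof (rule ccontr)
    assume "x \<noteq> 0"
    then obtain c p where c: "c \<noteq> 0" "p \<in> set points" "x = c *s toV p" by (rule points_cover)
    have "app m p \<noteq> V Z Z Z Z Z"
      using assms c(2) by (auto simp: list_all_iff nonzero_image_def split: if_splits)
    then have "collin m (toV p) \<noteq> 0" by (simp add: collin_toV toV_eq_0)
    moreover have "frob s c \<noteq> 0" using c(1) by (simp add: frob_def)
    ultimately show False using that unfolding c(3) csc by simp
  qed
  then have "inj (collin m)"
  proof -
    assume z: "\<And>x. collin m x = 0 \<Longrightarrow> x = 0"
    show ?thesis
    proof (rule injI)
      fix x y assume "collin m x = collin m y"
      then have "collin m (x - y) = 0" using cadd[of "x - y" y] by simp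
      then show "x = y" using z by force
    qed
  qed
  then have "bij (collin m)" by (simp add: bij_def finite_UNIV_inj_surj)
  moreover have "semilinear (collin m)"
    unfolding semilinear_def using cadd csc fa by blast
  ultimately show ?thesis by (simp add: GammaL_def)
qed

fun inside :: "vec5 list \<Rightarrow> vec5 list \<Rightarrow> bool" where
  "inside [] hs \<longleftrightarrow> True"
| "inside (g # gs) hs \<longleftrightarrow> (if perp g hs then inside gs hs else False)"

text \<open>Removes a single occurrence, so that matching respects multiplicities. Taking the first
  fit is safe: among subspaces of the right dimension, all that contain the image are equal to
  it.\<close>

fun pick :: "vec5 list \<Rightarrow> vec5 list list \<Rightarrow> vec5 list list option" where
  "pick gs [] = None"
| "pick gs (h # hs) = (if inside gs h then Some hs
     else case pick gs hs of None \<Rightarrow> None | Some r \<Rightarrow> Some (h # r))"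

fun matching :: "vec5 list list \<Rightarrow> vec5 list list \<Rightarrow> bool" where
  "matching [] hs \<longleftrightarrow> hs = []"
| "matching (gs # ss) hs \<longleftrightarrow> (case pick gs hs of None \<Rightarrow> False | Some r \<Rightarrow> matching ss r)"

definition kern :: "vec5 list \<Rightarrow> (gf4 ^ 5) set" where
  "kern hs = {x. \<forall>h\<in>set hs. dotp (toV h) x = 0}"

lemma inside_iff: "inside gs hs \<longleftrightarrow> (\<forall>g\<in>set gs. perp g hs)"
  by (induction gs) auto

lemma subspace_kern: "vec.subspace (kern hs)"
  by (auto simp: kern_def vec.subspace_def dotp_add_right dotp_scale_right)

lemma toV_in_kern: "toV v \<in> kern hs \<longleftrightarrow> perp v hs"
  by (auto simp: kern_def perp_iff dotp_toV dt_commute[of v])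

lemma sp_eq_kern:
  assumes "good gs"
  shows "sp gs = kern (ann gs)"
proof (rule Set.set_eqI)
  fix x :: "gf4 ^ 5"
  obtain v where "x = toV v" by (rule toV_surj)
  then show "x \<in> sp gs \<longleftrightarrow> x \<in> kern (ann gs)" by (simp add: good_sp(1)[OF assms] toV_in_kern)
qed

text \<open>Containment and equal dimensions force equality, so the image of a basis never has to be
  brought back to echelon form.\<close>

lemma collin_image_sp:
  assumes m: "collin m \<in> carrier GammaL" and "good gs" "vec.dim (kern h) = length gs"
    and i: "inside (map (app m) gs) h"
  shows "collin m ` sp gs = kern h"
proof (rule vec.subspace_dim_equal)
  show "vec.subspace (collin m ` sp gs)" by (rule subspace_image[OF m subspace_sp])
  show "vec.subspace (kern h)" by (rule subspace_kern)
  show "vec.dim (kern h) \<le> vec.dim (collin m ` sp gs)"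
    using assms good_sp(2) by (simp add: dim_image[OF m])
  have "collin m ` toV ` set gs = toV ` set (map (app m) gs)"
    by (simp add: image_image collin_toV)
  then have "collin m ` sp gs = sp (map (app m) gs)"
    unfolding sp_def span_image[OF m] by simp
  then show "collin m ` sp gs \<subseteq> kern h"
    using i by (simp add: sp_subset_iff[OF subspace_kern] inside_iff toV_in_kern)
qed

lemma pick_Some:
  "pick gs hs = Some r \<Longrightarrow> \<exists>h. mset hs = add_mset h (mset r) \<and> inside gs h"
  by (induction hs arbitrary: r) (auto split: if_splits option.splits)

lemma matching_image:
  assumes m: "collin m \<in> carrier GammaL"
  shows "matching (map (map (app m)) ss) hs \<Longrightarrow> valid k ss \<Longrightarrow> (\<forall>h\<in>set hs. vec.dim (kern h) = k) \<Longrightarrow>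
    image_mset ((`) (collin m)) (mset (map sp ss)) = mset (map kern hs)"
proof (induction ss arbitrary: hs)
  case Nil
  then show ?case by simp
next
  case (Cons gs ss)
  then obtain r where r: "pick (map (app m) gs) hs = Some r" "matching (map (map (app m)) ss) r"
    by (auto split: option.splits)
  obtain h where h: "mset hs = add_mset h (mset r)" "inside (map (app m) gs) h"
    using pick_Some[OF r(1)] by blast
  have hs: "set hs = insert h (set r)"
    using h(1) by (metis set_mset_mset set_mset_add_mset_insert)
  have g: "good gs" "length gs = k" "valid k ss" using Cons.prems(2) by (auto split: if_splits)
  have "collin m ` sp gs = kern h"
    using g h(2) hs Cons.prems(3) by (intro collin_image_sp[OF m]) auto
  moreover have "image_mset ((`) (collin m)) (mset (map sp ss)) = mset (map kern r)"
    using hs Cons.prems(3) by (intro Cons.IH r(2) g(3)) auto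
  ultimately show ?case by (simp add: h(1))
qed

definition collin_check :: "vec5 list list \<Rightarrow> vec5 list list \<Rightarrow> matrix5 \<Rightarrow> bool" where
  "collin_check Xs As m \<longleftrightarrow> (if list_all (nonzero_image m) points then
     if matching (map (map (app m)) Xs) (map ann Xs) then matching (map (map (app m)) As) (map ann As)
     else False else False)"

lemma valid_map_kern: "valid k ss \<Longrightarrow> map kern (map ann ss) = map sp ss"
  by (simp add: valid_iff sp_eq_kern)

lemma valid_dim_kern: "valid k ss \<Longrightarrow> h \<in> set (map ann ss) \<Longrightarrow> vec.dim (kern h) = k"
  by (auto simp: valid_iff good_sp(2) simp flip: sp_eq_kern)

lemma collin_automs:
  assumes "valid 2 Xs" "valid 3 As" "collin_check Xs As m"
  shows "collin m \<in> automs (design Xs As)"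
proof -
  have c: "list_all (nonzero_image m) points" "matching (map (map (app m)) Xs) (map ann Xs)"
    "matching (map (map (app m)) As) (map ann As)"
    using assms(3) by (simp_all add: collin_check_def split: if_splits)
  have m: "collin m \<in> carrier GammaL" by (rule collin_GammaL[OF c(1)])
  have "image_mset ((`) (collin m)) (mset (map sp Xs)) = mset (map sp Xs)"
    using matching_image[OF m c(2) assms(1)] valid_dim_kern[OF assms(1)]
    unfolding valid_map_kern[OF assms(1)] by blast
  moreover have "image_mset ((`) (collin m)) (mset (map sp As)) = mset (map sp As)"
    using matching_image[OF m c(3) assms(2)] valid_dim_kern[OF assms(2)]
    unfolding valid_map_kern[OF assms(2)] by blast
  ultimately show ?thesis by (simp only: automs_def design_def image_mset_union) (simp add: m)
qed

section \<open>The action on the lines\<close>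

definition pmul :: "nat list \<Rightarrow> nat list \<Rightarrow> nat list" where
  "pmul p r = map ((!) p) r"

definition induced :: "vec5 list list \<Rightarrow> vec5 list list \<Rightarrow> nat list \<Rightarrow> bool" where
  "induced Xs As p \<longleftrightarrow> set p \<subseteq> {..<length Xs} \<and> length p = length Xs \<and>
     (\<exists>f\<in>automs (design Xs As). map ((`) f) (map sp Xs) = map ((!) (map sp Xs)) p)"

fun perm_check :: "matrix5 \<Rightarrow> vec5 list list \<Rightarrow> nat list \<Rightarrow> vec5 list list \<Rightarrow> bool" where
  "perm_check m XA [] [] \<longleftrightarrow> True"
| "perm_check m XA (i # p) (gs # ss) \<longleftrightarrow> (if i < length XA then
     if inside (map (app m) gs) (XA ! i) then perm_check m XA p ss else False else False)"
| "perm_check m XA _ _ \<longleftrightarrow> False"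

fun orb :: "nat list \<Rightarrow> nat \<Rightarrow> nat list \<Rightarrow> nat list list" where
  "orb p 0 t = []"
| "orb p (Suc n) t = t # orb p n (pmul p t)"

text \<open>All products of powers of the generators in the fixed order of the list, each exponent
  running below the number paired with its generator. That they form a group is never asserted; only
  their number matters.\<close>

fun prods :: "(nat list \<times> nat) list \<Rightarrow> nat list \<Rightarrow> nat list list" where
  "prods [] e = [e]"
| "prods ((p, n) # r) e = concat (map (orb p n) (prods r e))"

lemma perm_check_induced:
  assumes v: "valid 2 Xs" "valid 3 As" "collin_check Xs As m" and p: "perm_check m (map ann Xs) p Xs"
  shows "induced Xs As p"
proof -
  have m: "collin m \<in> carrier GammaL" by (rule automs_GammaL[OF collin_automs[OF v]])
  have "set p \<subseteq> {..<length Xs} \<and> length p = length ss \<and>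
      map ((`) (collin m)) (map sp ss) = map ((!) (map sp Xs)) p"
    if "perm_check m (map ann Xs) p ss" "valid 2 ss" for p ss
    using that
  proof (induction p arbitrary: ss)
    case Nil
    then show ?case by (cases ss) auto
  next
    case (Cons i p)
    then obtain gs ss' where ss: "ss = gs # ss'" by (cases ss) auto
    have i: "i < length Xs" "inside (map (app m) gs) (ann (Xs ! i))" "perm_check m (map ann Xs) p ss'"
      using Cons.prems(1) by (auto simp: ss split: if_splits)
    have g: "good gs" "length gs = 2" "valid 2 ss'"
      using Cons.prems(2) by (auto simp: ss split: if_splits)
    have gi: "good (Xs ! i)" "length (Xs ! i) = 2" using v(1) i(1) by (auto simp: valid_iff)
    have "collin m ` sp gs = kern (ann (Xs ! i))"
      using g gi good_sp(2)[OF gi(1)] i(2) by (intro collin_image_sp[OF m]) (simp_all flip: sp_eq_kern)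
    then have "collin m ` sp gs = map sp Xs ! i" using i(1) by (simp add: sp_eq_kern[OF gi(1)])
    moreover note Cons.IH[OF i(3) g(3)]
    ultimately show ?case using i(1) by (simp add: ss)
  qed
  from this[OF p v(1)] show ?thesis
    unfolding induced_def using collin_automs[OF v] by blast
qed

lemma induced_pmul:
  assumes "induced Xs As p" "induced Xs As r"
  shows "induced Xs As (pmul p r)"
proof -
  let ?X = "map sp Xs"
  obtain f where p: "set p \<subseteq> {..<length Xs}" "length p = length Xs"
    and f: "f \<in> automs (design Xs As)" "map ((`) f) ?X = map ((!) ?X) p"
    using assms(1) unfolding induced_def by blast
  obtain g where r: "set r \<subseteq> {..<length Xs}" "length r = length Xs"
    and g: "g \<in> automs (design Xs As)" "map ((`) g) ?X = map ((!) ?X) r"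
    using assms(2) unfolding induced_def by blast
  have fi: "f ` (?X ! i) = ?X ! (p ! i)" if "i < length Xs" for i
    using arg_cong[OF f(2), of "\<lambda>l. l ! i"] that p(2) by simp
  have "map ((`) (f \<circ> g)) ?X = map ((`) f) (map ((`) g) ?X)" by (simp add: image_comp)
  also have "\<dots> = map (\<lambda>i. f ` (?X ! i)) r" unfolding g(2) by simp
  also have "\<dots> = map (\<lambda>i. ?X ! (p ! i)) r" using r(1) by (intro map_cong[OF refl] fi) auto
  finally have "map ((`) (f \<circ> g)) ?X = map ((!) ?X) (pmul p r)" by (simp add: pmul_def)
  moreover have "set (pmul p r) \<subseteq> {..<length Xs}"
    using p r by (force simp: pmul_def)
  ultimately show ?thesis
    unfolding induced_def using automs_comp[OF f(1) g(1)] r(2) by (auto simp: pmul_def)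
qed

lemma induced_id: "induced Xs As [0..<length Xs]"
proof -
  have "map ((`) id) (map sp Xs) = map ((!) (map sp Xs)) [0..<length Xs]"
    by (metis image_id length_map list.map_id map_nth)
  then show ?thesis unfolding induced_def using automs_id by (intro conjI bexI[of _ id]) auto
qed

lemma induced_prods:
  assumes "\<forall>(p, n)\<in>set gens. induced Xs As p"
  shows "t \<in> set (prods gens [0..<length Xs]) \<Longrightarrow> induced Xs As t"
  using assms
proof (induction gens arbitrary: t)
  case Nil
  then show ?case using induced_id by simp
next
  case (Cons g gens)
  obtain p n where g: "g = (p, n)" by (cases g)
  have p: "induced Xs As p" using Cons.prems(2) g by simp
  have *: "induced Xs As u" if "u \<in> set (orb p n s)" "induced Xs As s" for u n s
    using that by (induction n arbitrary: s) (auto intro: induced_pmul[OF p])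
  obtain s where "s \<in> set (prods gens [0..<length Xs])" "t \<in> set (orb p n s)"
    using Cons.prems(1) by (auto simp: g)
  then show ?case using * Cons.IH Cons.prems(2) by auto
qed

section \<open>Upper bound for the group order: a search pruned by invariants\<close>

section \<open>Incidences of lines\<close>

text \<open>The vanishing of the 2 by 2 determinant of the values of \<open>h1\<close>,
  \<open>h2\<close> on the two generators of a line.\<close>

fun meets :: "vec5 \<Rightarrow> vec5 \<Rightarrow> vec5 list \<Rightarrow> bool" where
  "meets h1 h2 [g1, g2] \<longleftrightarrow> qmul (dt h1 g1) (dt h2 g2) = qmul (dt h1 g2) (dt h2 g1)"
| "meets h1 h2 _ \<longleftrightarrow> False"

fun irow :: "vec5 list list \<Rightarrow> vec5 list \<Rightarrow> bool list" where
  "irow Xs [h1, h2] = map (meets h1 h2) Xs"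
| "irow Xs _ = []"

text \<open>Under \<open>code_simp\<close>, a conditional normalises the selected branch anew, including all the tables
  in it.  The strict functions \<open>sel\<close> and \<open>count_if\<close> avoid this.\<close>

fun sel :: "bool \<Rightarrow> 'a \<Rightarrow> 'a list \<Rightarrow> 'a list" where
  "sel True x xs = x # xs"
| "sel False x xs = xs"

fun count_if :: "bool \<Rightarrow> nat \<Rightarrow> nat" where
  "count_if True n = Suc n"
| "count_if False n = n"

fun pcount :: "bool list list \<Rightarrow> nat \<Rightarrow> nat \<Rightarrow> nat" where
  "pcount [] a b = 0"
| "pcount (J # Js) a b = count_if (J ! a \<and> J ! b) (pcount Js a b)"

definition prow :: "bool list list \<Rightarrow> nat list \<Rightarrow> nat \<Rightarrow> nat list" where
  "prow Js idx a = map (pcount Js a) idx"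

definition ptab :: "nat list \<Rightarrow> bool list list \<Rightarrow> nat list list" where
  "ptab idx Js = map (prow Js idx) idx"

fun normals :: "vec5 list \<Rightarrow> vec5 list \<Rightarrow> vec5 list" where
  "normals gs [] = []"
| "normals gs (h # hs) = sel (perp h gs) h (normals gs hs)"

definition nlist :: "vec5 list \<Rightarrow> vec5 list \<Rightarrow> vec5 list" where
  "nlist X Y = normals (X @ Y) points"

definition nrow :: "vec5 list list \<Rightarrow> vec5 list \<Rightarrow> vec5 list list" where
  "nrow Xs X = map (nlist X) Xs"

definition ntab :: "vec5 list list \<Rightarrow> vec5 list list list" where
  "ntab Xs = map (nrow Xs) Xs"

text \<open>Two distinct lines must be skew, so that they span a hyperplane with exactly one
  normalised normal vector. The diagonal is exempt, since a line lies in 21 hyperplanes; results on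
  the table of normals therefore assume distinct indices.\<close>

definition single :: "vec5 list list \<Rightarrow> nat \<Rightarrow> nat \<Rightarrow> bool" where
  "single R a b \<longleftrightarrow> (if a = b then True else length (R ! b) = 1)"

definition single_row :: "nat list \<Rightarrow> vec5 list list list \<Rightarrow> nat \<Rightarrow> bool" where
  "single_row idx NL a \<longleftrightarrow> list_all (single (NL ! a) a) idx"

definition normals_ok :: "nat list \<Rightarrow> vec5 list list list \<Rightarrow> bool" where
  "normals_ok idx NL \<longleftrightarrow> list_all (single_row idx NL) idx"

definition conc :: "vec5 list list \<Rightarrow> vec5 list list \<Rightarrow> nat \<Rightarrow> nat \<Rightarrow> nat \<Rightarrow> nat \<Rightarrow> bool" where
  "conc NT Xs a b c d \<longleftrightarrow> meets (NT ! a ! b) (NT ! a ! c) (Xs ! d)"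

lemma good_pairE:
  assumes "good gs" "length gs = 2"
  obtains g1 g2 \<psi>1 \<psi>2 where "gs = [g1, g2]" "dotp \<psi>1 (toV g1) = 1" "dotp \<psi>1 (toV g2) = 0"
    "dotp \<psi>2 (toV g1) = 0" "dotp \<psi>2 (toV g2) = 1"
proof -
  obtain g1 g2 where gs: "gs = [g1, g2]"
    using assms(2) by (auto simp: length_Suc_conv numeral_2_eq_2)
  obtain \<phi> where \<phi>: "\<forall>x\<in>toV ` set gs \<union> toV ` set (free gs). \<forall>y\<in>toV ` set gs \<union> toV ` set (free gs).
      dotp (\<phi> x) y = (if x = y then 1 else 0)"
    using good_dual(1)[OF assms(1)] by blast
  have "card (toV ` set gs) = 2" using good_dual(3)[OF assms(1)] assms(2) by simp
  then have "g1 \<noteq> g2" by (auto simp: gs)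
  then show thesis
    using \<phi> by (intro that[OF gs, of "\<phi> (toV g1)" "\<phi> (toV g2)"]) (auto simp: gs)
qed

lemma sp_pair: "x \<in> sp [g1, g2] \<longleftrightarrow> (\<exists>a b. x = a *s toV g1 + b *s toV g2)"
proof -
  have "x \<in> sp [g1, g2] \<longleftrightarrow> (\<exists>a b. x - a *s toV g1 = b *s toV g2)"
    by (auto simp: sp_def vec.span_insert vec.span_singleton)
  then show ?thesis by (metis add.commute diff_add_cancel diff_eq_eq)
qed

text \<open>One direction multiplies by the adjugate matrix. For the other, a non-zero row turned by
  a right angle, \<open>(B, - A)\<close> or \<open>(D, - C)\<close>, is a solution, and if both rows
  vanish anything is.\<close>

lemma det_zero_iff:
  fixes A B C D :: "'a::field"
  shows "(\<exists>a b. (a \<noteq> 0 \<or> b \<noteq> 0) \<and> a * A + b * B = 0 \<and> a * C + b * D = 0) \<longleftrightarrow> A * D = B * C"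
proof
  assume "\<exists>a b. (a \<noteq> 0 \<or> b \<noteq> 0) \<and> a * A + b * B = 0 \<and> a * C + b * D = 0"
  then obtain a b where ab: "a \<noteq> 0 \<or> b \<noteq> 0" "a * A + b * B = 0" "a * C + b * D = 0" by blast
  have "a * (A * D - B * C) = (a * A + b * B) * D - (a * C + b * D) * B" by (simp add: algebra_simps)
  moreover have "b * (A * D - B * C) = (a * C + b * D) * A - (a * A + b * B) * C" by (simp add: algebra_simps)
  ultimately have "a * (A * D - B * C) = 0" "b * (A * D - B * C) = 0" using ab by simp_all
  then show "A * D = B * C" using ab(1) by auto
next
  assume eq: "A * D = B * C"
  show "\<exists>a b. (a \<noteq> 0 \<or> b \<noteq> 0) \<and> a * A + b * B = 0 \<and> a * C + b * D = 0"
  proof (cases "A = 0 \<and> B = 0")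
    case True
    show ?thesis
    proof (cases "C = 0 \<and> D = 0")
      case True
      with \<open>A = 0 \<and> B = 0\<close> show ?thesis by (intro exI[of _ 1] exI[of _ 0]) simp
    next
      case False
      with \<open>A = 0 \<and> B = 0\<close> show ?thesis by (intro exI[of _ D] exI[of _ "- C"]) (auto simp: algebra_simps)
    qed
  next
    case False
    then show ?thesis using eq by (intro exI[of _ B] exI[of _ "- A"]) (auto simp: algebra_simps)
  qed
qed

text \<open>A non-zero vector of the line killed by both forms is a non-trivial combination of the
  generators whose coefficients solve the homogeneous system with this determinant.\<close>

lemma meets_iff:
  assumes "good X" "length X = 2"
  shows "meets h1 h2 X \<longleftrightarrow> kern [h1, h2] \<inter> sp X \<noteq> {0}"
proof -
  from assms obtain g1 g2 \<psi>1 \<psi>2 where X: "X = [g1, g2]"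
    and d: "dotp \<psi>1 (toV g1) = 1" "dotp \<psi>1 (toV g2) = 0" "dotp \<psi>2 (toV g1) = 0" "dotp \<psi>2 (toV g2) = 1"
    by (rule good_pairE)
  have nz: "a *s toV g1 + b *s toV g2 = 0 \<longleftrightarrow> a = 0 \<and> b = 0" for a b
  proof
    assume z: "a *s toV g1 + b *s toV g2 = 0"
    have "dotp \<psi>1 (a *s toV g1 + b *s toV g2) = a" "dotp \<psi>2 (a *s toV g1 + b *s toV g2) = b"
      by (simp_all add: dotp_add_right dotp_scale_right d)
    then show "a = 0 \<and> b = 0" unfolding z by simp
  qed simp
  have k: "a *s toV g1 + b *s toV g2 \<in> kern [h1, h2] \<longleftrightarrow>
      a * emb (dt h1 g1) + b * emb (dt h1 g2) = 0 \<and> a * emb (dt h2 g1) + b * emb (dt h2 g2) = 0" for a b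
    by (simp add: kern_def dotp_add_right dotp_scale_right dotp_toV)
  have "0 \<in> kern [h1, h2] \<inter> sp X"
    using subspace_kern subspace_sp by (simp add: vec.subspace_0)
  then have "kern [h1, h2] \<inter> sp X \<noteq> {0} \<longleftrightarrow> (\<exists>x. x \<noteq> 0 \<and> x \<in> kern [h1, h2] \<and> x \<in> sp X)" by blast
  also have "\<dots> \<longleftrightarrow> (\<exists>a b. (a \<noteq> 0 \<or> b \<noteq> 0) \<and>
      a * emb (dt h1 g1) + b * emb (dt h1 g2) = 0 \<and> a * emb (dt h2 g1) + b * emb (dt h2 g2) = 0)"
    unfolding X sp_pair using nz k by metis
  also have "\<dots> \<longleftrightarrow> emb (dt h1 g1) * emb (dt h2 g2) = emb (dt h1 g2) * emb (dt h2 g1)"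
    by (rule det_zero_iff)
  also have "\<dots> \<longleftrightarrow> meets h1 h2 X" by (simp add: X flip: emb_qmul)
  finally show ?thesis ..
qed

lemma pcount_eq: "pcount Js a b = length (filter (\<lambda>J. J ! a \<and> J ! b) Js)"
proof (induction Js)
  case (Cons J Js)
  then show ?case by (cases "J ! a \<and> J ! b") auto
qed simp

lemma normals_eq: "normals gs hs = filter (\<lambda>h. perp h gs) hs"
proof (induction hs)
  case (Cons h hs)
  then show ?case by (cases "perp h gs") auto
qed simp

lemma ann_pairE:
  assumes "good gs" "length gs = 3"
  obtains h1 h2 where "ann gs = [h1, h2]"
proof -
  have "length (ann gs) = Suc (Suc 0)" using assms by (auto simp: ann_def good_def Let_def)
  then show thesis using that by (auto simp: length_Suc_conv)
qed

lemma irow_nth: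
  assumes "valid 2 Xs" "good A" "length A = 3" "a < length Xs"
  shows "irow Xs (ann A) ! a \<longleftrightarrow> sp A \<inter> sp (Xs ! a) \<noteq> {0}"
proof -
  obtain h1 h2 where h: "ann A = [h1, h2]" using assms(2,3) by (rule ann_pairE)
  have "good (Xs ! a)" "length (Xs ! a) = 2" using assms(1,4) by (auto simp: valid_iff)
  from meets_iff[OF this] show ?thesis using assms(4) by (simp add: h sp_eq_kern[OF assms(2)])
qed

lemma size_filter_design:
  assumes "valid 2 Xs" "valid 3 As"
  shows "size (filter_mset (\<lambda>S. vec.dim S = 3 \<and> P S) (design Xs As)) = length (filter (\<lambda>A. P (sp A)) As)"
proof -
  have "filter (\<lambda>gs. vec.dim (sp gs) = 3 \<and> P (sp gs)) Xs = []"
    using assms(1) by (auto simp: filter_empty_conv valid_iff good_sp(2))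
  moreover have "filter (\<lambda>gs. vec.dim (sp gs) = 3 \<and> P (sp gs)) As = filter (\<lambda>A. P (sp A)) As"
    using assms(2) by (auto simp: valid_iff good_sp(2) intro: filter_cong)
  ultimately show ?thesis
    by (simp only: design_def filter_union_mset size_union size_filter_sp) simp
qed

lemma n2_pcount:
  assumes v: "valid 2 Xs" "valid 3 As" and ab: "a < length Xs" "b < length Xs"
  shows "n2 (design Xs As) (sp (Xs ! a)) (sp (Xs ! b)) = pcount (map (irow Xs) (map ann As)) a b"
proof -
  have "filter (\<lambda>A. sp A \<inter> sp (Xs ! a) \<noteq> {0} \<and> sp A \<inter> sp (Xs ! b) \<noteq> {0}) As =
      filter (\<lambda>A. irow Xs (ann A) ! a \<and> irow Xs (ann A) ! b) As"
    using v(2) by (intro filter_cong) (auto simp: valid_iff irow_nth[OF v(1)] ab)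
  then show ?thesis
    unfolding n2_def size_filter_design[OF v] by (simp add: pcount_eq filter_map comp_def)
qed

lemma joint_kern:
  assumes "nlist X Y = [n]"
  shows "joint (sp X) (sp Y) = kern [n]"
proof -
  have p: "p \<in> set points \<and> perp p X \<and> perp p Y \<longleftrightarrow> p = n" for p
  proof -
    have "p \<in> set (nlist X Y) \<longleftrightarrow> p = n" unfolding assms by simp
    then show ?thesis by (auto simp: nlist_def normals_eq perp_iff)
  qed
  have "{H. hyperplane H \<and> sp X \<subseteq> H \<and> sp Y \<subseteq> H} = {{x. dotp (toV n) x = 0}}"
  proof (intro equalityI subsetI)
    fix H assume "H \<in> {H. hyperplane H \<and> sp X \<subseteq> H \<and> sp Y \<subseteq> H}"
    then obtain q where "q \<in> set points" "H = {x. dotp (toV q) x = 0}" "sp X \<subseteq> H" "sp Y \<subseteq> H"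
      by (auto simp: hyperplane_iff)
    then show "H \<in> {{x. dotp (toV n) x = 0}}" using p[of q] by (simp add: sp_subset_kernel)
  next
    fix H assume "H \<in> {{x. dotp (toV n) x = 0}}"
    then show "H \<in> {H. hyperplane H \<and> sp X \<subseteq> H \<and> sp Y \<subseteq> H}"
      using p[of n] by (auto simp: hyperplane_iff sp_subset_kernel)
  qed
  then show ?thesis by (simp add: joint_def kern_def)
qed

lemma normals_nlist:
  assumes "normals_ok [0..<length Xs] (ntab Xs)" "a < length Xs" "b < length Xs" "a \<noteq> b"
  shows "nlist (Xs ! a) (Xs ! b) = [map (map hd) (ntab Xs) ! a ! b]"
proof -
  have "single (ntab Xs ! a) a b"
    using assms(1-3) by (simp add: normals_ok_def list_all_iff single_row_def)
  then have "length (nlist (Xs ! a) (Xs ! b)) = Suc 0"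
    using assms(2-4) by (simp add: single_def ntab_def nrow_def)
  then show ?thesis using assms(2,3) by (auto simp: length_Suc_conv ntab_def nrow_def)
qed

lemma conc_iff:
  assumes v: "valid 2 Xs" and nok: "normals_ok [0..<length Xs] (ntab Xs)"
    and lt: "a < length Xs" "b < length Xs" "c < length Xs" "d < length Xs" and ne: "a \<noteq> b" "a \<noteq> c"
  shows "conc (map (map hd) (ntab Xs)) Xs a b c d \<longleftrightarrow>
    concurrent (sp (Xs ! a)) (sp (Xs ! b)) (sp (Xs ! c)) (sp (Xs ! d))"
proof -
  have "good (Xs ! d)" "length (Xs ! d) = 2" using v lt(4) by (auto simp: valid_iff)
  note meets_iff[OF this, of "map (map hd) (ntab Xs) ! a ! b" "map (map hd) (ntab Xs) ! a ! c"]
  moreover have "kern [h] \<inter> kern [h'] = kern [h, h']" for h h' by (auto simp: kern_def)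
  ultimately show ?thesis
    by (simp only: conc_def concurrent_def joint_kern[OF normals_nlist[OF nok lt(1,2) ne(1)]]
        joint_kern[OF normals_nlist[OF nok lt(1,3) ne(2)]])
qed

section \<open>Search for the permutations of the lines\<close>

type_synonym quad = "nat \<times> nat \<times> nat \<times> nat"

text \<open>Compares the row of a newly placed line with that of its proposed image, on the lines
  placed so far including the new one; the diagonal entry is thus tested too.\<close>

fun okrow :: "nat list \<Rightarrow> nat list \<Rightarrow> nat list \<Rightarrow> bool" where
  "okrow rk rx [] \<longleftrightarrow> True"
| "okrow (r # rk) rx (y # ys) \<longleftrightarrow> (if rx ! y = r then okrow rk rx ys else False)"
| "okrow [] rx (y # ys) \<longleftrightarrow> False"

fun okquads :: "vec5 list list \<Rightarrow> vec5 list list \<Rightarrow> quad list \<Rightarrow> nat list \<Rightarrow> bool" where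
  "okquads NT Xs [] q \<longleftrightarrow> True"
| "okquads NT Xs ((a, b, c, d) # qs) q \<longleftrightarrow>
     conc NT Xs (q ! a) (q ! b) (q ! c) (q ! d) = conc NT Xs a b c d \<and> okquads NT Xs qs q"

fun mem :: "nat \<Rightarrow> nat list \<Rightarrow> bool" where
  "mem x [] \<longleftrightarrow> False"
| "mem x (y # ys) \<longleftrightarrow> (if x = y then True else mem x ys)"

fun extend :: "nat list \<Rightarrow> nat list list \<Rightarrow> nat list \<Rightarrow> nat list \<Rightarrow> nat list list" where
  "extend rk N2 [] p = []"
| "extend rk N2 (x # xs) p =
     sel (\<not> mem x p \<and> okrow rk (N2 ! x) (p @ [x])) (p @ [x]) (extend rk N2 xs p)"

fun keep :: "vec5 list list \<Rightarrow> vec5 list list \<Rightarrow> quad list \<Rightarrow> nat list list \<Rightarrow> nat list list" where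
  "keep NT Xs qs [] = []"
| "keep NT Xs qs (q # L) = sel (okquads NT Xs qs q) q (keep NT Xs qs L)"

fun search :: "nat list list \<Rightarrow> vec5 list list \<Rightarrow> vec5 list list \<Rightarrow> nat list \<Rightarrow> nat \<Rightarrow> quad list list \<Rightarrow>
    nat list list \<Rightarrow> nat list list" where
  "search N2 NT Xs idx k [] L = L"
| "search N2 NT Xs idx k (qs # cert) L =
     search N2 NT Xs idx (Suc k) cert (keep NT Xs qs (concat (map (extend (N2 ! k) N2 idx) L)))"

fun quad_ok :: "nat \<Rightarrow> quad \<Rightarrow> bool" where
  "quad_ok k (a, b, c, d) \<longleftrightarrow> a \<noteq> b \<and> a \<noteq> c \<and> a \<le> k \<and> b \<le> k \<and> c \<le> k \<and> d \<le> k"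

fun cert_ok :: "nat \<Rightarrow> quad list list \<Rightarrow> bool" where
  "cert_ok k [] \<longleftrightarrow> True"
| "cert_ok k (qs # cert) \<longleftrightarrow> (if list_all (quad_ok k) qs then cert_ok (Suc k) cert else False)"

lemma mem_iff: "mem x ys \<longleftrightarrow> x \<in> set ys"
  by (induction ys) auto

lemma okrowI:
  "length q \<le> length rk \<Longrightarrow> (\<And>a. a < length q \<Longrightarrow> rx ! (q ! a) = rk ! a) \<Longrightarrow> okrow rk rx q"
proof (induction rk rx q rule: okrow.induct)
  case (2 r rk rx y ys)
  have "okrow rk rx ys"
  proof (rule "2.IH")
    show "rx ! y = r" using "2.prems"(2)[of 0] by simp
    show "length ys \<le> length rk" using "2.prems"(1) by simp
    show "rx ! (ys ! a) = rk ! a" if "a < length ys" for a using "2.prems"(2)[of "Suc a"] that by simp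
  qed
  then show ?case using "2.prems"(2)[of 0] by simp
qed auto

lemma okquadsI:
  "(\<And>a b c d. (a, b, c, d) \<in> set qs \<Longrightarrow>
      conc NT Xs (q ! a) (q ! b) (q ! c) (q ! d) = conc NT Xs a b c d) \<Longrightarrow> okquads NT Xs qs q"
  by (induction NT Xs qs q rule: okquads.induct) auto

lemma set_sel: "set (sel b x xs) = (if b then insert x (set xs) else set xs)"
  by (cases b) auto

lemma extendI:
  "x \<in> set xs \<Longrightarrow> x \<notin> set p \<Longrightarrow> okrow rk (N2 ! x) (p @ [x]) \<Longrightarrow> p @ [x] \<in> set (extend rk N2 xs p)"
  by (induction xs) (auto simp: mem_iff set_sel)

lemma keepI: "q \<in> set L \<Longrightarrow> okquads NT Xs qs q \<Longrightarrow> q \<in> set (keep NT Xs qs L)"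
  by (induction L) (auto simp: set_sel)

text \<open>Completeness alone is shown: a permutation preserving the table and the concurrency
  relation has prefixes that pass every test. \<open>quad_ok k\<close> makes this possible, as a
  quadruple used at stage \<open>k\<close> mentions only lines whose images are already
  known.\<close>

lemma search_complete:
  fixes p :: "nat list"
  assumes p: "length p = m" "set p \<subseteq> {..<m}" "distinct p"
    and N2: "length N2 = m" "\<And>a. a < m \<Longrightarrow> length (N2 ! a) = m"
      "\<And>a b. a < m \<Longrightarrow> b < m \<Longrightarrow> N2 ! (p ! a) ! (p ! b) = N2 ! a ! b"
    and conc: "\<And>a b c d. a < m \<Longrightarrow> b < m \<Longrightarrow> c < m \<Longrightarrow> d < m \<Longrightarrow> a \<noteq> b \<Longrightarrow> a \<noteq> c \<Longrightarrow>
      conc NT Xs (p ! a) (p ! b) (p ! c) (p ! d) = conc NT Xs a b c d"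
  shows "cert_ok k cert \<Longrightarrow> k + length cert = m \<Longrightarrow> take k p \<in> set L \<Longrightarrow>
    p \<in> set (search N2 NT Xs [0..<m] k cert L)"
proof (induction cert arbitrary: k L)
  case Nil
  then show ?case using p(1) by simp
next
  case (Cons qs cert)
  have k: "k < m" using Cons.prems(2) by simp
  have q: "list_all (quad_ok k) qs" "cert_ok (Suc k) cert"
    using Cons.prems(1) by (auto split: if_splits)
  have t: "take (Suc k) p = take k p @ [p ! k]" using k p(1) by (simp add: take_Suc_conv_app_nth)
  have pk: "p ! k < m" using k p(1,2) by (metis lessThan_iff nth_mem subset_iff)
  have nth: "take (Suc k) p ! a = p ! a" if "a \<le> k" for a using that by simp
  have ext: "take k p @ [p ! k] \<in> set (extend (N2 ! k) N2 [0..<m] (take k p))"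
  proof (rule extendI)
    show "p ! k \<in> set [0..<m]" using pk by simp
    show "p ! k \<notin> set (take k p)"
      using p(1,3) k by (auto simp: in_set_conv_nth nth_eq_iff_index_eq)
    show "okrow (N2 ! k) (N2 ! (p ! k)) (take k p @ [p ! k])"
      unfolding t[symmetric] using k p(1) N2 by (intro okrowI) auto
  qed
  have "okquads NT Xs qs (take (Suc k) p)"
  proof (rule okquadsI)
    fix a b c d assume "(a, b, c, d) \<in> set qs"
    then have "quad_ok k (a, b, c, d)" using q(1) unfolding list_all_iff by blast
    then show "conc NT Xs (take (Suc k) p ! a) (take (Suc k) p ! b) (take (Suc k) p ! c) (take (Suc k) p ! d) =
        conc NT Xs a b c d"
      using k by (simp add: nth conc)
  qed
  moreover have "take (Suc k) p \<in> set (concat (map (extend (N2 ! k) N2 [0..<m]) L))"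
    unfolding t using Cons.prems(3) ext by auto
  ultimately have "take (Suc k) p \<in> set (keep NT Xs qs (concat (map (extend (N2 ! k) N2 [0..<m]) L)))"
    by (intro keepI)
  then show ?case using Cons.IH[OF q(2)] Cons.prems(2) by simp
qed

section \<open>Faithfulness of the action on the lines\<close>

section \<open>Collineations fixing all lines\<close>

fun comps :: "vec5 \<Rightarrow> q4 list" where
  "comps (V a b c d e) = [a, b, c, d, e]"

lemma toV_units:
  "toV (V I Z Z Z Z) = axis 1 1" "toV (V Z I Z Z Z) = axis 2 1" "toV (V Z Z I Z Z) = axis 3 1"
  "toV (V Z Z Z I Z) = axis 4 1" "toV (V Z Z Z Z I) = axis 5 1"
  by (auto simp: vec_eq_iff toV.simps axis_def emb_I emb_Z) (metis exhaust_5)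

lemma toV_component: "a \<in> set (comps v) \<Longrightarrow> \<exists>i. toV v $ i = emb a"
proof (cases v)
  case (V a1 a2 a3 a4 a5)
  assume "a \<in> set (comps v)"
  moreover have "toV v $ 1 = emb a1" "toV v $ 2 = emb a2" "toV v $ 3 = emb a3" "toV v $ 4 = emb a4"
    "toV v $ 5 = emb a5" by (simp_all add: V toV.simps)
  ultimately show ?thesis using V by auto
qed

text \<open>The last point \<open>u\<close>, with two coordinates in ratio \<open>w\<close>, excludes the Frobenius automorphism.\<close>

lemma frame_scalar:
  fixes f :: "gf4 ^ 5 \<Rightarrow> gf4 ^ 5"
  assumes f: "f \<in> carrier GammaL"
    and fix_units: "\<And>t. t \<in> set (V I I I I I # u # units) \<Longrightarrow> \<exists>c. f (toV t) = c *s toV t"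
    and u: "I \<in> set (comps u)" "W \<in> set (comps u)"
  shows "f \<in> scalar_maps"
proof -
  obtain \<sigma> where \<sigma>: "field_automorphism \<sigma>" "\<And>c x. f (c *s x) = \<sigma> c *s f x"
    "\<And>x y. f (x + y) = f x + f y" "f 0 = 0" "bij f" by (rule GammaL_cases[OF f]) blast
  have "\<exists>c. f (axis i 1) = c *s axis i 1" for i :: 5
    using exhaust_5[of i] fix_units[of "V I Z Z Z Z"] fix_units[of "V Z I Z Z Z"] fix_units[of "V Z Z I Z Z"]
      fix_units[of "V Z Z Z I Z"] fix_units[of "V Z Z Z Z I"]
    by (auto simp: units_def toV_units)
  then obtain e where e: "\<And>i :: 5. f (axis i 1) = e i *s axis i 1" by metis
  have fsum: "f (\<Sum>i\<in>A. g i) = (\<Sum>i\<in>A. f (g i))" for g :: "5 \<Rightarrow> gf4 ^ 5" and A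
    by (induction A rule: infinite_finite_induct) (simp_all add: \<sigma>(3,4))
  \<comment> \<open>Fixing the five unit points makes \<open>f\<close> diagonal up to \<sigma>; the
    all-one point then equalises the diagonal entries, and only \<sigma> remains to be
    excluded.\<close>
  have fx: "f x $ i = \<sigma> (x $ i) * e i" for x i
  proof -
    have "f x = f (\<Sum>j\<in>UNIV. x $ j *s axis j 1)" by (simp only: basis_expansion)
    also have "\<dots> = (\<Sum>j\<in>UNIV. (\<sigma> (x $ j) * e j) *s axis j 1)"
      unfolding fsum \<sigma>(2) e by (simp add: mult.commute)
    also have "\<dots> $ i = \<sigma> (x $ i) * e i"
      by (simp add: axis_def if_distrib[of "(*) _"] cong: if_cong)
    finally show ?thesis .
  qed
  obtain c where c: "f (toV (V I I I I I)) = c *s toV (V I I I I I)" using fix_units by auto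
  have one: "toV (V I I I I I) $ i = 1" for i by (simp add: toV.simps emb_I)
  have ei: "e i = c" for i
    using arg_cong[OF c, of "\<lambda>v. v $ i"] \<sigma>(1) by (simp add: fx one)
  obtain c' where c': "f (toV u) = c' *s toV u" using fix_units by auto
  obtain i j where ij: "toV u $ i = 1" "toV u $ j = emb W"
    using toV_component[OF u(1)] toV_component[OF u(2)] by (auto simp: emb_I)
  \<comment> \<open>The coordinate 1 of \<open>u\<close> fixes its multiplier, so the coordinate w
    yields \<sigma>(w) = w.\<close>
  have "c' = c" using arg_cong[OF c', of "\<lambda>v. v $ i"] \<sigma>(1) by (simp add: fx ei ij)
  have cnz: "c \<noteq> 0"
  proof
    assume "c = 0"
    then have "f (axis 1 1) = f 0" by (simp add: e ei \<sigma>(4))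
    then have "axis 1 1 = (0 :: gf4 ^ 5)" using \<sigma>(5) by (simp add: bij_is_inj inj_eq)
    then show False by (simp add: axis_eq_0_iff)
  qed
  have W: "\<sigma> (emb W) = emb W"
    using arg_cong[OF c', of "\<lambda>v. v $ j"] cnz by (simp add: fx ei ij \<open>c' = c\<close>)
  have "\<sigma> (emb U) = \<sigma> (emb W + 1)" by (simp add: emb.simps one_gf4_def)
  also have "\<dots> = emb W + 1" using \<sigma>(1) W by (simp add: field_automorphism_def field_automorphism_1[OF \<sigma>(1)])
  also have "\<dots> = emb U" by (simp add: emb.simps one_gf4_def)
  finally have U: "\<sigma> (emb U) = emb U" .
  have "\<sigma> x = x" for x
  proof -
    obtain y where "x = emb y" by (rule emb_surj)
    then show ?thesis using W U \<sigma>(1) by (cases y) (simp_all add: emb_I emb_Z)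
  qed
  then have "f = (\<lambda>x. c *s x)" by (simp add: fun_eq_iff vec_eq_iff fx ei mult.commute)
  then show ?thesis using cnz by (simp add: scalar_mapsI)
qed

fun frame_ok :: "vec5 list list \<Rightarrow> vec5 list list \<Rightarrow> vec5 list list \<Rightarrow> (nat \<times> nat \<times> nat) list \<Rightarrow>
    vec5 list \<Rightarrow> bool" where
  "frame_ok NT Xs XA [] [] \<longleftrightarrow> True"
| "frame_ok NT Xs XA ((i, j, k) # fs) (t # ts) \<longleftrightarrow>
     (if i \<noteq> j \<and> i < length Xs \<and> j < length Xs \<and> k < length Xs then
        if perp t (XA ! k) then if dt (NT ! i ! j) t = Z then if perp (NT ! i ! j) (Xs ! k) then False
          else frame_ok NT Xs XA fs ts else False else False else False)"
| "frame_ok NT Xs XA _ _ \<longleftrightarrow> False"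

text \<open>A map fixing all lines fixes the hyperplane spanned by lines \<open>i\<close> and
  \<open>j\<close>, hence its intersection with line \<open>k\<close>. As line \<open>k\<close> is
  not contained in that hyperplane, the intersection is one-dimensional and spanned by
  \<open>t\<close>.\<close>

lemma fixed_point:
  assumes v: "valid 2 Xs" and nok: "normals_ok [0..<length Xs] (ntab Xs)"
    and ijk: "i \<noteq> j" "i < length Xs" "j < length Xs" "k < length Xs"
    and t: "t \<noteq> V Z Z Z Z Z" "perp t (ann (Xs ! k))"
    and n: "dt n t = Z" "\<not> perp n (Xs ! k)" "n = map (map hd) (ntab Xs) ! i ! j"
    and f: "f \<in> carrier GammaL" "\<And>X. X \<in> set (map sp Xs) \<Longrightarrow> f ` X = X"
  shows "\<exists>c. f (toV t) = c *s toV t"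
proof -
  let ?Q = "kern [n] \<inter> sp (Xs ! k)"
  have g: "good (Xs ! k)" "length (Xs ! k) = 2" using v ijk(4) by (auto simp: valid_iff)
  have inj: "inj f" using f(1) by (simp add: GammaL_def bij_is_inj)
  have j: "joint (sp (Xs ! i)) (sp (Xs ! j)) = kern [n]"
    unfolding n(3) by (rule joint_kern[OF normals_nlist[OF nok ijk(2,3,1)]])
  have fX: "f ` sp (Xs ! i) = sp (Xs ! i)" if "i < length Xs" for i using f(2) that by simp
  have "f ` kern [n] = kern [n]"
    unfolding j[symmetric] joint_image[OF f(1), symmetric] by (simp add: fX ijk)
  then have fQ: "f ` ?Q = ?Q" by (simp add: image_Int[OF inj] fX ijk)
  have tQ: "toV t \<in> ?Q" using t(2) n(1) by (simp add: good_sp(1)[OF g(1)] toV_in_kern dt_commute[of t])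
  have subQ: "vec.subspace ?Q" by (intro vec.subspace_inter subspace_kern subspace_sp)
  obtain x where x: "x \<in> set (Xs ! k)" "dt n x \<noteq> Z" using n(2) by (auto simp: perp_iff)
  then have "toV x \<in> sp (Xs ! k)" "toV x \<notin> ?Q" by (simp_all add: in_sp toV_in_kern dt_commute[of x])
  then have "?Q \<subset> sp (Xs ! k)" by blast
  then have "vec.dim ?Q < vec.dim (sp (Xs ! k))"
    using subQ by (intro vec.dim_psubset) (simp add: vec.span_eq_iff[THEN iffD2])
  then have "vec.dim ?Q \<le> 1" using good_sp(2)[OF g(1)] g(2) by simp
  moreover have "vec.dim (vec.span {toV t}) = 1"
    using t(1) by (subst vec.dim_span_eq_card_independent) (auto simp: toV_eq_0)
  moreover have "vec.span {toV t} \<subseteq> ?Q" using tQ subQ by (intro vec.span_minimal) auto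
  ultimately have "vec.span {toV t} = ?Q"
    using subQ by (intro vec.subspace_dim_equal) auto
  moreover have "f (toV t) \<in> ?Q" using imageI[OF tQ, of f] unfolding fQ .
  ultimately show ?thesis by (auto simp: vec.span_singleton)
qed

lemma frame_ok_fixes:
  assumes v: "valid 2 Xs" and nok: "normals_ok [0..<length Xs] (ntab Xs)"
    and f: "f \<in> carrier GammaL" "\<And>X. X \<in> set (map sp Xs) \<Longrightarrow> f ` X = X"
  shows "frame_ok (map (map hd) (ntab Xs)) Xs (map ann Xs) fs ts \<Longrightarrow> V Z Z Z Z Z \<notin> set ts \<Longrightarrow>
    t \<in> set ts \<Longrightarrow> \<exists>c. f (toV t) = c *s toV t"
proof (induction fs arbitrary: ts)
  case Nil
  then show ?case by (cases ts) auto
next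
  case (Cons q fs)
  obtain i j k where q: "q = (i, j, k)" by (cases q)
  obtain s ts' where ts: "ts = s # ts'" using Cons.prems(1) by (cases ts) auto
  let ?n = "map (map hd) (ntab Xs) ! i ! j"
  have h: "i \<noteq> j" "i < length Xs" "j < length Xs" "k < length Xs" "perp s (map ann Xs ! k)"
    "dt ?n s = Z" "\<not> perp ?n (Xs ! k)" "frame_ok (map (map hd) (ntab Xs)) Xs (map ann Xs) fs ts'"
    using Cons.prems(1) by (simp_all add: q ts split: if_splits)
  have "\<exists>c. f (toV s) = c *s toV s"
    using fixed_point[OF v nok h(1-4) _ _ h(6,7) refl f] h(4,5) Cons.prems(2) ts by auto
  then show ?case using Cons.IH[OF h(8)] Cons.prems(2,3) ts by auto
qed

text \<open>In part (c), all points in which a line meets the span of two others lie in a subgeometry over the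
  field with two elements.  The point \<open>u\<close> is therefore one that is singled out on its line by \<^const>\<open>n3\<close>.\<close>

fun n3count :: "(vec5 list \<times> bool list) list \<Rightarrow> nat \<Rightarrow> vec5 \<Rightarrow> nat" where
  "n3count [] j v = 0"
| "n3count ((h, J) # r) j v = (if J ! j then if perp v h then Suc (n3count r j v) else n3count r j v
     else n3count r j v)"

fun lpts :: "vec5 list \<Rightarrow> vec5 list" where
  "lpts [g1, g2] = [g2, g1, vadd g1 g2, vadd g1 (vscale W g2), vadd g1 (vscale U g2)]"
| "lpts _ = []"

definition proportional :: "vec5 \<Rightarrow> vec5 \<Rightarrow> bool" where
  "proportional u q \<longleftrightarrow> (if q = u then True else if vscale W q = u then True else vscale U q = u)"

definition n3_unique :: "(vec5 list \<times> bool list) list \<Rightarrow> nat \<Rightarrow> vec5 \<Rightarrow> nat \<Rightarrow> vec5 \<Rightarrow> bool" where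
  "n3_unique AJ j u n q \<longleftrightarrow> (if n3count AJ j q = n then proportional u q else True)"

lemma n3_n3count:
  assumes v: "valid 2 Xs" "valid 3 As" and j: "j < length Xs"
  shows "n3 (design Xs As) (toV p) (sp (Xs ! j)) =
    n3count (zip (map ann As) (map (irow Xs) (map ann As))) j p"
proof -
  have "n3count (zip (map ann As) (map (irow Xs) (map ann As))) j p =
      length (filter (\<lambda>A. perp p (ann A) \<and> irow Xs (ann A) ! j) As)"
    by (induction As) auto
  also have "\<dots> = length (filter (\<lambda>A. toV p \<in> sp A \<and> sp A \<inter> sp (Xs ! j) \<noteq> {0}) As)"
    using v(2) by (intro arg_cong[where f = length] filter_cong)
      (auto simp: valid_iff irow_nth[OF v(1)] j good_sp(1))
  finally show ?thesis by (simp add: n3_def size_filter_design[OF v])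
qed

lemma qadd_Z: "qadd x Z = x"
  by (cases x) simp_all

lemma lpts_cover:
  assumes "x \<in> sp X" "x \<noteq> 0" "length X = 2"
  obtains c q where "c \<noteq> 0" "q \<in> set (lpts X)" "x = c *s toV q"
proof -
  obtain g1 g2 where X: "X = [g1, g2]"
    using assms(3) by (auto simp: length_Suc_conv numeral_2_eq_2)
  obtain a b where x: "x = a *s toV g1 + b *s toV g2" using assms(1) unfolding X sp_pair by blast
  show thesis
  proof (cases "a = 0")
    case True
    then show ?thesis using x assms(2) by (intro that[of b g2]) (auto simp: X)
  next
    case False
    obtain y where y: "b / a = emb y" by (rule emb_surj)
    have "x = a *s toV (vadd g1 (vscale y g2))"
      using False by (simp add: x toV_vadd toV_vscale vec.scale_right_distrib flip: y)
    moreover have "vadd g1 (vscale y g2) \<in> set (lpts X)"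
      by (cases y; cases g1; cases g2) (simp_all add: X qadd_Z)
    ultimately show ?thesis using False by (intro that)
  qed
qed

text \<open>The image of \<open>u\<close> is again a point of line \<open>k\<close> with the same
  \<open>n3\<close> value against the fixed line \<open>j\<close>; among the five points of line
  \<open>k\<close> only \<open>u\<close> has this value.\<close>

lemma n3_unique_fixes:
  assumes v: "valid 2 Xs" "valid 3 As" and jk: "j < length Xs" "k < length Xs"
    and u: "u \<noteq> V Z Z Z Z Z" "perp u (ann (Xs ! k))"
    and uniq: "list_all (n3_unique AJ j u (n3count AJ j u)) (lpts (Xs ! k))"
    and AJ: "AJ = zip (map ann As) (map (irow Xs) (map ann As))"
    and f: "f \<in> automs (design Xs As)" "\<And>X. X \<in> set (map sp Xs) \<Longrightarrow> f ` X = X"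
  shows "\<exists>c. f (toV u) = c *s toV u"
proof -
  have g: "good (Xs ! k)" "length (Xs ! k) = 2" using v(1) jk(2) by (auto simp: valid_iff)
  have fX: "f ` sp (Xs ! i) = sp (Xs ! i)" if "i < length Xs" for i using f(2) that by simp
  have "toV u \<in> sp (Xs ! k)" using u(2) by (simp add: good_sp(1)[OF g(1)])
  then have "f (toV u) \<in> sp (Xs ! k)" using imageI[of "toV u" "sp (Xs ! k)" f] fX[OF jk(2)] by simp
  moreover have "f (toV u) \<noteq> 0"
  proof -
    have "bij f" "f 0 = 0" using GammaL_cases[OF automs_GammaL[OF f(1)]] by metis+
    then show ?thesis using u(1) inj_eq[OF bij_is_inj, of f "toV u" 0] by (simp add: toV_eq_0)
  qed
  ultimately obtain c q where q: "c \<noteq> 0" "q \<in> set (lpts (Xs ! k))" "f (toV u) = c *s toV q"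
    using g(2) by (rule lpts_cover)
  have "n3count AJ j q = n3 (design Xs As) (toV q) (sp (Xs ! j))"
    by (simp add: AJ n3_n3count[OF v jk(1)])
  also have "\<dots> = n3 (design Xs As) (f (toV u)) (f ` sp (Xs ! j))"
    by (simp add: q(3) n3_scale[OF q(1) design_subspace] fX jk(1))
  also have "\<dots> = n3count AJ j u"
    by (simp add: n3_image[OF f(1)] AJ n3_n3count[OF v jk(1)])
  finally have "proportional u q" using uniq q(2) by (auto simp: list_all_iff n3_unique_def split: if_splits)
  then have "\<exists>d. d \<noteq> 0 \<and> toV u = d *s toV q"
  proof -
    consider "q = u" | "vscale W q = u" | "vscale U q = u"
      using \<open>proportional u q\<close> by (auto simp: proportional_def split: if_splits)
    then show ?thesis
    proof cases
      case 1
      then show ?thesis by (intro exI[of _ 1]) simp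
    next
      case 2
      then show ?thesis using toV_vscale[of W q] by (intro exI[of _ "emb W"]) simp
    next
      case 3
      then show ?thesis using toV_vscale[of U q] by (intro exI[of _ "emb U"]) simp
    qed
  qed
  then obtain d where d: "d \<noteq> 0" "toV u = d *s toV q" by (elim exE conjE)
  have "toV q = inverse d *s toV u" unfolding d(2) using d(1) by simp
  then have "f (toV u) = (c * inverse d) *s toV u" unfolding q(3) by simp
  then show ?thesis ..
qed

section \<open>Assembling the two bounds\<close>

section \<open>Certificates\<close>

fun distinct_lines :: "vec5 list list \<Rightarrow> vec5 list list \<Rightarrow> bool" where
  "distinct_lines [] _ \<longleftrightarrow> True"
| "distinct_lines (X # Xs) (h # hs) \<longleftrightarrow> (if list_ex (inside X) hs then False else distinct_lines Xs hs)"
| "distinct_lines (X # Xs) [] \<longleftrightarrow> False"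

definition faithful_check :: "vec5 list list \<Rightarrow> vec5 list list \<Rightarrow> vec5 list list \<Rightarrow>
    (vec5 list \<times> bool list) list \<Rightarrow> (nat \<times> nat \<times> nat) list \<Rightarrow> nat \<Rightarrow> nat \<Rightarrow> vec5 \<Rightarrow> bool" where
  "faithful_check NT Xs XA AJ fs j k u \<longleftrightarrow>
     frame_ok NT Xs XA fs (V I I I I I # units) \<and> j < length Xs \<and> k < length Xs \<and> u \<noteq> V Z Z Z Z Z \<and>
     perp u (XA ! k) \<and> I \<in> set (comps u) \<and> W \<in> set (comps u) \<and>
     list_all (n3_unique AJ j u (n3count AJ j u)) (lpts (Xs ! k))"

text \<open>The tables enter as arguments, so that evaluation normalises each of them once, before
  the body that mentions them several times is unfolded.\<close>

definition upper_check :: "nat \<Rightarrow> vec5 list list \<Rightarrow> vec5 list list \<Rightarrow> vec5 list list list \<Rightarrow> bool list list \<Rightarrow>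
    vec5 list list \<Rightarrow> vec5 list list \<Rightarrow> quad list list \<Rightarrow> (nat \<times> nat \<times> nat) list \<Rightarrow> nat \<Rightarrow> nat \<Rightarrow> vec5 \<Rightarrow> bool" where
  "upper_check N Xs As NL Js XA AA cert fs j k u \<longleftrightarrow>
     normals_ok [0..<length Xs] NL \<and> distinct_lines Xs XA \<and> cert_ok 0 cert \<and> length cert = length Xs \<and>
     faithful_check (map (map hd) NL) Xs XA (zip AA Js) fs j k u \<and>
     length (search (ptab [0..<length Xs] Js) (map (map hd) NL) Xs [0..<length Xs] 0 cert [[]]) = N"

fun gens_check :: "vec5 list list \<Rightarrow> vec5 list list \<Rightarrow> matrix5 list \<Rightarrow> (nat list \<times> nat) list \<Rightarrow> bool" where
  "gens_check Xs As [] [] \<longleftrightarrow> True"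
| "gens_check Xs As (m # ms) ((p, n) # ps) \<longleftrightarrow>
     (if collin_check Xs As m then if perm_check m (map ann Xs) p Xs then gens_check Xs As ms ps else False
      else False)"
| "gens_check Xs As _ _ \<longleftrightarrow> False"

lemma distinct_lines_sp:
  "distinct_lines Xs (map ann Xs) \<Longrightarrow> valid 2 Xs \<Longrightarrow> distinct (map sp Xs)"
proof (induction Xs)
  case (Cons X Xs)
  have g: "good X" "valid 2 Xs" using Cons.prems(2) by (auto split: if_splits)
  have "sp X \<noteq> sp Y" if "Y \<in> set Xs" for Y
  proof
    assume eq: "sp X = sp Y"
    have "good Y" using g(2) that by (simp add: valid_iff)
    then have "inside X (ann Y)" using in_sp[of _ X] eq by (auto simp: inside_iff simp flip: good_sp(1))
    then show False using Cons.prems(1) that by (auto simp: list_ex_iff split: if_splits)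
  qed
  then show ?case using Cons g(2) by (auto split: if_splits)
qed simp

text \<open>The dimension separates the two kinds of members, so the two-dimensional ones are
  permuted among themselves; their distinctness turns this into a permutation of positions.\<close>

lemma automs_perm:
  assumes v: "valid 2 Xs" "valid 3 As" and d: "distinct (map sp Xs)"
    and f: "f \<in> automs (design Xs As)"
  obtains p where "length p = length Xs" "set p \<subseteq> {..<length Xs}" "distinct p"
    "\<And>i. i < length Xs \<Longrightarrow> f ` sp (Xs ! i) = sp (Xs ! (p ! i))"
proof -
  have G: "f \<in> carrier GammaL" using f by (rule automs_GammaL)
  have "\<exists>j<length Xs. f ` sp (Xs ! i) = sp (Xs ! j)" if i: "i < length Xs" for i
  proof -
    have "sp (Xs ! i) \<in># design Xs As" using i by (simp add: design_def)
    then have "f ` sp (Xs ! i) \<in># image_mset ((`) f) (design Xs As)" by auto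
    moreover have "image_mset ((`) f) (design Xs As) = design Xs As" using f by (simp add: automs_def)
    ultimately have "f ` sp (Xs ! i) \<in># design Xs As" by (simp only:)
    then have "f ` sp (Xs ! i) \<in> sp ` set Xs \<or> f ` sp (Xs ! i) \<in> sp ` set As"
      by (simp add: design_def)
    moreover have "vec.dim (f ` sp (Xs ! i)) = 2"
      using v(1) i by (simp add: dim_image[OF G] valid_iff good_sp(2))
    moreover have "vec.dim S = 3" if "S \<in> sp ` set As" for S
      using that v(2) by (auto simp: valid_iff good_sp(2))
    ultimately have "f ` sp (Xs ! i) \<in> sp ` set Xs" by force
    then obtain X where "X \<in> set Xs" "f ` sp (Xs ! i) = sp X" by (rule imageE)
    then show ?thesis by (metis in_set_conv_nth)
  qed
  then obtain p' where p': "\<And>i. i < length Xs \<Longrightarrow> p' i < length Xs \<and> f ` sp (Xs ! i) = sp (Xs ! p' i)"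
    by metis
  have inj: "inj f" using G by (simp add: GammaL_def bij_is_inj)
  have "inj_on p' {..<length Xs}"
  proof (rule inj_onI)
    fix i j assume ij: "i \<in> {..<length Xs}" "j \<in> {..<length Xs}" "p' i = p' j"
    then have "f ` sp (Xs ! i) = f ` sp (Xs ! j)" using p' by simp
    then have "map sp Xs ! i = map sp Xs ! j" using ij inj_image_eq_iff[OF inj] by simp
    then show "i = j" using nth_eq_iff_index_eq[OF d, of i j] ij by simp
  qed
  then show thesis
    using p' by (intro that[of "map p' [0..<length Xs]"]) (auto simp: distinct_map atLeast0LessThan)
qed

lemma gens_check_induced:
  assumes "valid 2 Xs" "valid 3 As"
  shows "gens_check Xs As ms ps \<Longrightarrow> \<forall>(p, n)\<in>set ps. induced Xs As p"
proof (induction ms arbitrary: ps)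
  case Nil
  then show ?case by (cases ps) auto
next
  case (Cons m ms)
  then obtain p n ps' where ps: "ps = (p, n) # ps'" by (cases ps) auto
  have h: "collin_check Xs As m" "perm_check m (map ann Xs) p Xs" "gens_check Xs As ms ps'"
    using Cons.prems by (auto simp: ps split: if_splits)
  then show ?case
    using Cons.IH[OF h(3)] perm_check_induced[OF assms h(1,2)] by (simp add: ps)
qed

text \<open>The lists of images of the lines under automorphisms are enclosed between the
  \<open>N\<close> products of the generators and the \<open>N\<close> survivors of the search.
  Comparing prefixes of length \<open>r\<close> is enough to see that the products are
  distinct.\<close>

theorem realisation:
  assumes v: "valid 2 Xs" "valid 3 As"
    and hyp: "list_all (hyp_check Xs As) points"
    and pt: "list_all (pt_check mu (map ann Xs) (map ann As)) points"
    and upper: "upper_check N Xs As (ntab Xs) (map (irow Xs) (map ann As)) (map ann Xs) (map ann As) cert fs j k u"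
    and gens: "gens_check Xs As ms ps"
    and prods: "distinct (map (take r) (prods ps [0..<length Xs]))" "length (prods ps [0..<length Xs]) = N"
    and len: "length Xs = nx" "length As = na" and lam: "lam = 3 * nx"
  shows "\<exists>\<S> :: (gf4 ^ 5) set multiset.
        (\<forall>S\<in>#\<S>. vec.subspace S \<and> vec.dim S \<in> {2, 3}) \<and>
        size (filter_mset (\<lambda>S. vec.dim S = 2) \<S>) = nx \<and>
        size (filter_mset (\<lambda>S. vec.dim S = 3) \<S>) = na \<and>
        (\<forall>H. hyperplane H \<longrightarrow> size (filter_mset (\<lambda>S. S \<subseteq> H) \<S>) = 2) \<and>
        multispread lam mu 3 \<S> \<and>
        order (aut_group \<S>) = N"
proof -
  let ?D = "design Xs As" and ?m = "length Xs" and ?X = "map sp Xs"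
  let ?NT = "map (map hd) (ntab Xs)" and ?Js = "map (irow Xs) (map ann As)"
  let ?N2 = "ptab [0..<?m] ?Js"
  let ?\<Phi> = "\<lambda>f. map ((`) f) ?X"
  let ?T = "search ?N2 ?NT Xs [0..<?m] 0 cert [[]]"
  have nok: "normals_ok [0..<?m] (ntab Xs)" and dl: "distinct_lines Xs (map ann Xs)"
    and cert: "cert_ok 0 cert" "length cert = ?m"
    and faithful: "faithful_check ?NT Xs (map ann Xs) (zip (map ann As) ?Js) fs j k u"
    and T: "length ?T = N"
    using upper unfolding upper_check_def by blast+
  have d: "distinct ?X" by (rule distinct_lines_sp[OF dl v(1)])
  have "f \<in> scalar_maps" if f: "f \<in> automs ?D" and fX: "\<And>X. X \<in> set ?X \<Longrightarrow> f ` X = X" for f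
  proof (rule frame_scalar)
    show "f \<in> carrier GammaL" using f by (rule automs_GammaL)
    show "I \<in> set (comps u)" "W \<in> set (comps u)" using faithful unfolding faithful_check_def by blast+
    have h: "frame_ok ?NT Xs (map ann Xs) fs (V I I I I I # units)" "j < ?m" "k < ?m" "u \<noteq> V Z Z Z Z Z"
      "perp u (map ann Xs ! k)"
      "list_all (n3_unique (zip (map ann As) ?Js) j u (n3count (zip (map ann As) ?Js) j u)) (lpts (Xs ! k))"
      using faithful unfolding faithful_check_def by blast+
    have "\<exists>c. f (toV u) = c *s toV u"
      using h(3,5) by (intro n3_unique_fixes[OF v h(2,3,4) _ h(6) refl f fX]) simp_all
    moreover have "\<exists>c. f (toV t) = c *s toV t" if "t \<in> set (V I I I I I # units)" for t
      using that by (intro frame_ok_fixes[OF v(1) nok automs_GammaL[OF f] fX h(1)]) (auto simp: units_def)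
    ultimately show "\<exists>c. f (toV t) = c *s toV t" if "t \<in> set (V I I I I I # u # units)" for t
      using that by auto
  qed
  then have ord: "order (aut_group ?D) = card (?\<Phi> ` automs ?D)"
    by (intro order_aut_group) (auto intro: design_subspace)
  \<comment> \<open>Upper bound: the permutation of positions induced by an automorphism preserves
    both invariants and so survives the search.\<close>
  have "?\<Phi> ` automs ?D \<subseteq> (\<lambda>p. map ((!) ?X) p) ` set ?T"
  proof (rule image_subsetI)
    fix f assume f: "f \<in> automs ?D"
    obtain p where p: "length p = ?m" "set p \<subseteq> {..<?m}" "distinct p"
      "\<And>i. i < ?m \<Longrightarrow> f ` sp (Xs ! i) = sp (Xs ! (p ! i))"
      by (rule automs_perm[OF v d f]) blast
    have pl: "p ! i < ?m" if "i < ?m" for i using p(1,2) that by (metis lessThan_iff nth_mem subset_iff)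
    have pne: "p ! a \<noteq> p ! b" if "a < ?m" "b < ?m" "a \<noteq> b" for a b
      using p(1,3) that by (simp add: nth_eq_iff_index_eq)
    have N2: "?N2 ! a ! b = n2 ?D (sp (Xs ! a)) (sp (Xs ! b))" if "a < ?m" "b < ?m" for a b
      using that by (simp add: n2_pcount[OF v that] ptab_def prow_def)
    have "p \<in> set ?T"
    proof (rule search_complete[OF p(1-3)])
      show "length ?N2 = ?m" by (simp add: ptab_def)
      show "length (?N2 ! a) = ?m" if "a < ?m" for a using that by (simp add: ptab_def prow_def)
      show "?N2 ! (p ! a) ! (p ! b) = ?N2 ! a ! b" if "a < ?m" "b < ?m" for a b
        using that by (simp only: N2 pl p(4)[symmetric] n2_image[OF f])
      show "conc ?NT Xs (p ! a) (p ! b) (p ! c) (p ! d) = conc ?NT Xs a b c d"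
        if "a < ?m" "b < ?m" "c < ?m" "d < ?m" "a \<noteq> b" "a \<noteq> c" for a b c d
        using that by (simp only: conc_iff[OF v(1) nok] pl pne not_False_eq_True p(4)[symmetric]
            concurrent_image[OF automs_GammaL[OF f]])
    qed (use cert in simp_all)
    moreover have "?\<Phi> f = map ((!) ?X) p"
      using p(1,4) pl by (intro nth_equalityI) simp_all
    ultimately show "?\<Phi> f \<in> (\<lambda>p. map ((!) ?X) p) ` set ?T" by blast
  qed
  then have "card (?\<Phi> ` automs ?D) \<le> card ((\<lambda>p. map ((!) ?X) p) ` set ?T)" by (intro card_mono) auto
  also have "\<dots> \<le> card (set ?T)" by (rule card_image_le) simp
  also have "\<dots> \<le> N" using T card_length by metis
  finally have le: "card (?\<Phi> ` automs ?D) \<le> N" .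
  have fin: "finite (?\<Phi> ` automs ?D)"
    by (rule finite_subset[OF \<open>?\<Phi> ` automs ?D \<subseteq> _\<close>]) simp
  have ind: "induced Xs As t" if "t \<in> set (prods ps [0..<?m])" for t
    by (rule induced_prods[OF gens_check_induced[OF v gens] that])
  \<comment> \<open>Distinct index lists give distinct lists of subspaces because the lines are
    distinct; this yields the lower bound.\<close>
  have "inj_on (map ((!) ?X)) (set (prods ps [0..<?m]))"
  proof (rule inj_onI)
    fix s t assume st: "s \<in> set (prods ps [0..<?m])" "t \<in> set (prods ps [0..<?m])"
      and eq: "map ((!) ?X) s = map ((!) ?X) t"
    have s: "set s \<subseteq> {..<?m}" "length s = ?m" and t: "set t \<subseteq> {..<?m}" "length t = ?m"
      using ind[OF st(1)] ind[OF st(2)] by (simp_all add: induced_def)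
    show "s = t"
    proof (rule nth_equalityI)
      fix i assume i: "i < length s"
      then have "?X ! (s ! i) = ?X ! (t ! i)" using arg_cong[OF eq, of "\<lambda>l. l ! i"] s t by simp
      moreover have "s ! i < ?m" "t ! i < ?m" using i s t by (metis lessThan_iff nth_mem subset_iff)+
      ultimately show "s ! i = t ! i" using nth_eq_iff_index_eq[OF d, of "s ! i" "t ! i"] by simp
    qed (use s t in simp)
  qed
  then have c: "card (map ((!) ?X) ` set (prods ps [0..<?m])) = N"
    using prods by (simp add: card_image distinct_card distinct_map)
  have "map ((!) ?X) ` set (prods ps [0..<?m]) \<subseteq> ?\<Phi> ` automs ?D"
  proof (rule image_subsetI)
    fix t assume "t \<in> set (prods ps [0..<?m])"
    then obtain f where "f \<in> automs ?D" "?\<Phi> f = map ((!) ?X) t"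
      using ind unfolding induced_def by blast
    then show "map ((!) ?X) t \<in> ?\<Phi> ` automs ?D" by (intro image_eqI[of _ _ f]) simp_all
  qed
  from card_mono[OF fin this] have "order (aut_group ?D) = N"
    using le unfolding c ord by (rule le_antisym[rotated])
  with design_spec[OF v hyp pt, unfolded len, folded lam] show ?thesis by (intro exI[of _ ?D] conjI)
qed

section \<open>The explicit multisets and their certificates\<close>

text \<open>In each \<open>quads\<close> list, the entry at position \<open>k\<close> holds the quadruples whose concurrency is compared
  once the images of lines \<open>0\<close> to \<open>k\<close> are chosen.  The coordinates are such that, for the successive triples
  \<open>(i, j, k)\<close> of a \<open>frame\<close> list, line \<open>k\<close> meets the span of lines \<open>i\<close> and \<open>j\<close> in the all-one vector and in
  the unit vectors.\<close>

section \<open>Seventeen lines\<close>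

definition lines_a :: "vec5 list list" where
  "lines_a = [
    [V I Z Z Z Z, V Z I Z Z Z], [V Z Z I Z Z, V Z Z Z I Z], [V I Z I U W, V Z I W W W],
    [V I I I W Z, V Z Z Z Z I], [V I Z Z I Z, V Z Z I U I], [V I Z Z W W, V Z I W Z I],
    [V I Z U I W, V Z I W W U], [V I Z I Z U, V Z I W W Z], [V I Z U W I, V Z I I U U],
    [V Z I Z W W, V Z Z I U W], [V I Z W I U, V Z I W W I], [V I Z W W I, V Z I U U Z],
    [V I Z Z W I, V Z I W I I], [V I Z Z W Z, V Z I U W W], [V I Z Z U Z, V Z I Z I U],
    [V I Z Z W U, V Z I I W W], [V I U Z U U, V Z Z I U U]]"

definition planes_a :: "vec5 list list" where
  "planes_a = [
    [V I Z I Z W, V Z I Z Z W, V Z Z Z I U], [V I Z Z I W, V Z I Z U W, V Z Z I W U],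
    [V I Z Z I W, V Z I Z U U, V Z Z I W I], [V I Z Z Z W, V Z I Z U I, V Z Z I Z U],
    [V I Z Z I I, V Z I Z Z W, V Z Z I I I], [V I Z Z Z W, V Z I Z U Z, V Z Z I W I],
    [V I Z U Z Z, V Z I U I Z, V Z Z Z Z I], [V I Z Z Z Z, V Z I Z W Z, V Z Z I W W],
    [V I Z Z I U, V Z I Z Z W, V Z Z I W W], [V I Z U Z U, V Z I I Z Z, V Z Z Z I W],
    [V I Z Z Z U, V Z I Z I U, V Z Z I I U], [V I Z Z I I, V Z I Z U I, V Z Z I I W],
    [V I Z I Z I, V Z I I Z Z, V Z Z Z I U], [V I Z Z U W, V Z I Z Z I, V Z Z I U U],
    [V I Z Z U I, V Z I Z W I, V Z Z I W U], [V I Z Z U W, V Z I Z U Z, V Z Z I I I],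
    [V I Z Z U I, V Z I Z U W, V Z Z I Z I], [V I Z Z U I, V Z I Z Z I, V Z Z I W W],
    [V I Z I Z I, V Z I I Z U, V Z Z Z I W], [V I Z W Z Z, V Z I Z Z I, V Z Z Z I Z],
    [V I Z Z I U, V Z I Z U W, V Z Z I I I], [V I Z Z Z I, V Z I Z I W, V Z Z I W U],
    [V I Z W Z I, V Z I I Z W, V Z Z Z I I], [V I Z Z U I, V Z I Z W Z, V Z Z I I I],
    [V I Z Z I I, V Z I Z I W, V Z Z I Z U], [V I Z Z Z U, V Z I Z W W, V Z Z I I U],
    [V I Z Z Z U, V Z I Z U W, V Z Z I I U], [V I Z U Z Z, V Z I Z Z I, V Z Z Z I U],
    [V I Z Z U W, V Z I Z I Z, V Z Z I I W], [V I Z Z I W, V Z I Z I I, V Z Z I I W],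
    [V I Z Z Z I, V Z I U Z I, V Z Z Z I U], [V I Z Z Z I, V Z I Z U W, V Z Z I Z Z],
    [V I Z Z U U, V Z I Z Z W, V Z Z I W I], [V I Z U Z W, V Z I U Z Z, V Z Z Z I U],
    [V I Z Z Z I, V Z I Z I Z, V Z Z I Z I], [V I Z Z Z U, V Z I Z I I, V Z Z I I U],
    [V I Z W Z U, V Z I W Z W, V Z Z Z I W], [V I Z Z I Z, V Z I Z I W, V Z Z I Z I],
    [V I Z Z Z W, V Z I Z Z U, V Z Z I Z W], [V I Z Z I I, V Z I Z Z U, V Z Z I Z W],
    [V I Z Z W W, V Z I Z W I, V Z Z I I I], [V I Z Z Z U, V Z I Z W U, V Z Z I I U],
    [V I Z Z U U, V Z I Z W I, V Z Z I W W], [V I W Z Z W, V Z Z I Z U, V Z Z Z I I],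
    [V I Z W Z Z, V Z I Z Z W, V Z Z Z I W], [V I Z I Z W, V Z I U Z Z, V Z Z Z I I],
    [V I Z U Z I, V Z I Z Z Z, V Z Z Z I W], [V I Z Z I U, V Z I Z Z U, V Z Z I Z W],
    [V I Z Z Z W, V Z I Z W U, V Z Z I W U], [V I Z Z U I, V Z I Z U Z, V Z Z I I W],
    [V I Z W Z U, V Z I I Z U, V Z Z Z I I], [V I Z I Z Z, V Z I U Z I, V Z Z Z I I],
    [V I Z Z U U, V Z I Z Z U, V Z Z I Z W], [V I Z Z Z W, V Z I Z W Z, V Z Z I U W],
    [V I Z Z W U, V Z I Z Z I, V Z Z I W I], [V I Z Z I U, V Z I Z U I, V Z Z I Z I],
    [V I Z Z Z I, V Z I Z U Z, V Z Z I W W], [V I Z Z U W, V Z I Z Z U, V Z Z I Z W],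
    [V I Z Z U W, V Z I Z U U, V Z Z I Z U], [V I Z Z I W, V Z I Z I Z, V Z Z I I Z],
    [V I Z Z U U, V Z I Z W Z, V Z Z I Z I], [V I Z Z W I, V Z I Z I Z, V Z Z I Z U],
    [V I Z Z I I, V Z I Z I I, V Z Z I U I], [V I Z Z U Z, V Z I Z U U, V Z Z I W U],
    [V I Z Z I U, V Z I Z W U, V Z Z I W Z]]"

definition gens_a :: "matrix5 list" where
  "gens_a = [
    (V Z U W Z W, V Z I Z W W, V I U W Z Z, V Z I W W U, V Z Z U W W, False),
    (V U Z I Z I, V U Z W W W, V U I U I U, V Z I W W I, V I I U Z W, True),
    (V Z U U W W, V U Z W I U, V W W Z U I, V Z I Z I U, V I W U W Z, False)]"

definition perms_a :: "(nat list \<times> nat) list" where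
  "perms_a = [
    ([9, 6, 2, 16, 14, 0, 15, 10, 3, 11, 5, 4, 12, 8, 1, 13, 7], 15),
    ([4, 10, 2, 13, 8, 9, 0, 7, 6, 1, 5, 15, 12, 14, 16, 11, 3], 4),
    ([8, 14, 12, 5, 6, 3, 4, 7, 0, 13, 16, 15, 2, 9, 1, 11, 10], 2)]"

definition quads_a :: "quad list list" where
  "quads_a = [
    [], [], [], [(3, 2, 1, 0)], [], [(4, 5, 1, 2), (0, 5, 4, 3)], [(1, 6, 2, 4)], [(1, 5, 3, 7)],
    [], [(9, 1, 0, 7)], [(0, 10, 2, 9)], [(2, 11, 3, 9)], [], [(1, 13, 4, 9)], [(13, 14, 12, 9)],
    [], []]"

definition frame_a :: "(nat \<times> nat \<times> nat) list" where
  "frame_a = [(0, 2, 11), (1, 4, 0), (3, 4, 0), (3, 5, 1), (0, 4, 1), (1, 4, 3)]"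

lemma a_valid: "valid 2 lines_a" "valid 3 planes_a"
  by code_simp+

lemma a_hyperplanes: "list_all (hyp_check lines_a planes_a) points"
  by code_simp

lemma a_points: "list_all (pt_check 5 (map ann lines_a) (map ann planes_a)) points"
  by code_simp

lemma a_upper:
  "upper_check 120 lines_a planes_a (ntab lines_a)
     (map (irow lines_a) (map ann planes_a)) (map ann lines_a) (map ann planes_a) quads_a frame_a 5 1 (V Z Z I W Z)"
  by code_simp

lemma a_gens: "gens_check lines_a planes_a gens_a perms_a"
  by code_simp

lemma a_prods:
  "distinct (map (take 5) (prods perms_a [0..<length lines_a]))"
  "length (prods perms_a [0..<length lines_a]) = 120"
  by code_simp+

lemma a_lengths: "length lines_a = 17" "length planes_a = 65"
  by code_simp+

section \<open>Twelve lines\<close>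

definition lines_b :: "vec5 list list" where
  "lines_b = [
    [V I Z Z Z Z, V Z I Z Z Z], [V Z Z I Z Z, V Z Z Z I Z], [V I Z I U Z, V Z I Z Z W],
    [V I Z W I U, V Z I W Z Z], [V I Z Z I W, V Z I W W W], [V I U W W Z, V Z Z Z Z I],
    [V I Z W I I, V Z I U Z Z], [V I Z I I W, V Z I U W I], [V I Z W I W, V Z I W U U],
    [V I Z U Z I, V Z Z Z I U], [V I Z Z U I, V Z I Z Z U], [V I Z I W I, V Z I Z Z I]]"

definition planes_b :: "vec5 list list" where
  "planes_b = [
    [V I Z Z W U, V Z I Z U I, V Z Z I I Z], [V I Z I Z U, V Z I U Z W, V Z Z Z I Z],
    [V I Z Z Z Z, V Z I Z U U, V Z Z I U Z], [V Z I Z Z Z, V Z Z I Z Z, V Z Z Z I W],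
    [V I I Z Z Z, V Z Z I Z W, V Z Z Z I I], [V I Z Z W U, V Z I Z W W, V Z Z I W W],
    [V I Z Z W W, V Z I Z W I, V Z Z I W I], [V I Z Z Z U, V Z I Z U W, V Z Z I U W],
    [V I Z W Z W, V Z I I Z Z, V Z Z Z I W], [V I Z W Z I, V Z I I Z Z, V Z Z Z I I],
    [V I W Z Z W, V Z Z I Z Z, V Z Z Z I Z], [V I Z Z Z Z, V Z I Z Z Z, V Z Z I Z I],
    [V I Z Z I W, V Z I Z W Z, V Z Z I I I], [V I Z Z W U, V Z I Z Z W, V Z Z I W I],
    [V I Z U Z W, V Z I Z Z I, V Z Z Z I W], [V I Z Z I U, V Z I Z Z U, V Z Z I I I],
    [V I Z Z Z W, V Z I U Z Z, V Z Z Z I U], [V I Z I Z U, V Z I I Z I, V Z Z Z I I],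
    [V I Z Z I I, V Z I Z I U, V Z Z I Z I], [V I Z W Z Z, V Z I U Z U, V Z Z Z I W],
    [V I Z U Z Z, V Z I I U Z, V Z Z Z Z I], [V I Z Z Z W, V Z I W Z Z, V Z Z Z I I],
    [V I Z Z U I, V Z I Z U W, V Z Z I U U], [V I Z Z W W, V Z I Z I W, V Z Z I U W],
    [V I Z Z W Z, V Z I Z U W, V Z Z I W W], [V I Z Z W W, V Z I Z U W, V Z Z I U I],
    [V I Z Z U U, V Z I Z I U, V Z Z I Z W], [V I Z Z I Z, V Z I Z Z I, V Z Z I U U],
    [V I Z Z I I, V Z I Z W I, V Z Z I W W], [V I Z Z U U, V Z I Z W I, V Z Z I Z I],
    [V I Z Z W W, V Z I Z W U, V Z Z I I U], [V I Z Z I U, V Z I Z U I, V Z Z I W W],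
    [V I Z Z U W, V Z I Z U Z, V Z Z I I W], [V I Z Z U Z, V Z I Z U W, V Z Z I Z W],
    [V I Z U Z U, V Z I U Z I, V Z Z Z I U], [V I Z Z Z U, V Z I Z U Z, V Z Z I I I],
    [V I Z Z Z U, V Z I Z U I, V Z Z I I U], [V I Z Z Z U, V Z I Z W I, V Z Z I W U],
    [V I Z Z I W, V Z I Z I U, V Z Z I I W], [V I Z Z Z U, V Z I Z I U, V Z Z I I W],
    [V I Z Z I Z, V Z I Z U U, V Z Z I Z I], [V I Z Z I I, V Z I Z W I, V Z Z I U I],
    [V I Z Z I U, V Z I Z W Z, V Z Z I W W], [V I Z Z W W, V Z I Z W Z, V Z Z I Z W],
    [V I Z Z W W, V Z I Z Z W, V Z Z I I I], [V I Z Z W Z, V Z I Z W I, V Z Z I Z U],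
    [V I Z Z Z I, V Z I Z I Z, V Z Z I W W], [V I Z Z I U, V Z I Z I Z, V Z Z I U W],
    [V I Z Z Z U, V Z I Z I I, V Z Z I Z I], [V I Z Z U Z, V Z I Z U U, V Z Z I Z I],
    [V I Z Z I I, V Z I Z U I, V Z Z I I I], [V I Z W U Z, V Z I Z I Z, V Z Z Z Z I],
    [V I Z Z U W, V Z I Z U U, V Z Z I U W], [V I Z Z I U, V Z I Z I Z, V Z Z I U I],
    [V I Z Z Z I, V Z I Z I W, V Z Z I Z U], [V I Z Z W Z, V Z I Z W U, V Z Z I I U],
    [V I Z Z W I, V Z I Z W Z, V Z Z I U I], [V I Z Z I Z, V Z I Z W U, V Z Z I U W],
    [V I Z Z I Z, V Z I Z U W, V Z Z I W U], [V I Z Z I I, V Z I Z U Z, V Z Z I I I],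
    [V I Z Z U Z, V Z I Z Z U, V Z Z I W U], [V I Z Z W I, V Z I Z U I, V Z Z I U W],
    [V I Z Z W I, V Z I Z U Z, V Z Z I Z U], [V I Z Z W I, V Z I Z I I, V Z Z I I U],
    [V I Z Z Z W, V Z I Z W Z, V Z Z I Z U], [V I Z Z U Z, V Z I Z I W, V Z Z I W I],
    [V I Z Z U Z, V Z I Z W W, V Z Z I W I], [V I Z Z Z W, V Z I Z W W, V Z Z I I U],
    [V I Z Z W Z, V Z I Z I I, V Z Z I Z W], [V I Z I Z I, V Z I W Z U, V Z Z Z I I],
    [V I Z Z Z W, V Z I Z U U, V Z Z I W I], [V I Z Z W Z, V Z I Z I I, V Z Z I I W],
    [V I Z Z W U, V Z I Z U U, V Z Z I Z U], [V I Z Z U U, V Z I Z W U, V Z Z I U U],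
    [V I Z Z U W, V Z I Z I W, V Z Z I U U], [V I Z Z U U, V Z I Z I Z, V Z Z I W U],
    [V I Z Z Z I, V Z I Z U Z, V Z Z I W U], [V I Z Z Z I, V Z I Z W W, V Z Z I I W],
    [V I Z Z Z I, V Z I Z W W, V Z Z I Z W], [V I Z Z U W, V Z I Z W Z, V Z Z I U U],
    [V I Z Z U W, V Z I Z W U, V Z Z I W I], [V I Z Z Z W, V Z I I Z W, V Z Z Z I W],
    [V I Z Z W I, V Z I Z I I, V Z Z I Z U], [V I Z I Z U, V Z I W Z U, V Z Z Z I W],
    [V I Z Z U U, V Z I Z I Z, V Z Z I U U], [V I Z Z Z I, V Z I I Z W, V Z Z Z I I]]"

definition gens_b :: "matrix5 list" where
  "gens_b = [
    (V W W Z Z Z, V W I Z Z Z, V Z Z W W Z, V Z Z W I Z, V Z I U W I, False),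
    (V Z I Z Z Z, V W W Z Z Z, V Z Z I W Z, V Z Z W I Z, V I I Z W I, True),
    (V Z Z I W Z, V Z Z Z I Z, V I W Z Z Z, V Z I Z Z Z, V W U W Z I, False)]"

definition perms_b :: "(nat list \<times> nat) list" where
  "perms_b = [
    ([0, 1, 4, 5, 6, 7, 8, 9, 10, 11, 2, 3], 5), ([0, 1, 3, 4, 7, 8, 11, 2, 5, 6, 9, 10], 4),
    ([1, 0, 11, 10, 9, 8, 7, 6, 5, 4, 3, 2], 2)]"

definition quads_b :: "quad list list" where
  "quads_b = [
    [], [], [], [], [(4, 3, 2, 0)], [(4, 5, 3, 1)], [], [], [], [], [], []]"

definition frame_b :: "(nat \<times> nat \<times> nat) list" where
  "frame_b = [(0, 4, 6), (1, 2, 0), (1, 3, 0), (0, 3, 1), (2, 3, 1), (0, 2, 5)]"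

lemma b_valid: "valid 2 lines_b" "valid 3 planes_b"
  by code_simp+

lemma b_hyperplanes: "list_all (hyp_check lines_b planes_b) points"
  by code_simp

lemma b_points: "list_all (pt_check 6 (map ann lines_b) (map ann planes_b)) points"
  by code_simp

lemma b_upper:
  "upper_check 40 lines_b planes_b (ntab lines_b)
     (map (irow lines_b) (map ann planes_b)) (map ann lines_b) (map ann planes_b) quads_b frame_b 5 0 (V W I Z Z Z)"
  by code_simp

lemma b_gens: "gens_check lines_b planes_b gens_b perms_b"
  by code_simp

lemma b_prods:
  "distinct (map (take 4) (prods perms_b [0..<length lines_b]))"
  "length (prods perms_b [0..<length lines_b]) = 40"
  by code_simp+

lemma b_lengths: "length lines_b = 12" "length planes_b = 86"
  by code_simp+

section \<open>Seven lines\<close>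

text \<open>All generators have coordinates 0 and 1, so the coordinatewise Frobenius map fixes each
  of the seven lines. Only the planes can rule it out as an automorphism.\<close>

definition lines_c :: "vec5 list list" where
  "lines_c = [
    [V I I I Z Z, V Z Z Z I Z], [V I Z Z Z Z, V Z Z I Z I], [V Z I I I Z, V Z Z Z Z I],
    [V I I Z Z I, V Z Z I Z Z], [V I Z I I Z, V Z I I Z Z], [V I Z Z I I, V Z Z I I I],
    [V I Z I I I, V Z I Z Z Z]]"

text \<open>The first two entries are the same subspace, fixed by the collineation of order 7: this
  is a genuine multiset.\<close>

definition planes_c :: "vec5 list list" where
  "planes_c = [
    [V I Z Z Z I, V Z I Z Z I, V Z Z Z I I], [V I Z Z Z I, V Z I Z Z I, V Z Z Z I I],
    [V I Z Z U U, V Z I Z I I, V Z Z I W I], [V I Z U Z Z, V Z I Z Z U, V Z Z Z I W],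
    [V I Z Z U Z, V Z I Z I I, V Z Z I W W], [V I Z Z Z W, V Z I Z I I, V Z Z I U W],
    [V I Z Z I U, V Z I Z I I, V Z Z I U Z], [V I Z Z W U, V Z I Z I I, V Z Z I W I],
    [V I Z Z U I, V Z I Z I I, V Z Z I I W], [V I Z I Z W, V Z I W Z I, V Z Z Z I Z],
    [V I Z Z Z Z, V Z I Z U Z, V Z Z I Z U], [V I Z Z W Z, V Z I W U Z, V Z Z Z Z I],
    [V I Z Z Z U, V Z I Z Z W, V Z Z I W W], [V I Z W Z Z, V Z I W Z U, V Z Z Z I U],
    [V I Z Z I I, V Z I Z U W, V Z Z I Z W], [V I Z Z I W, V Z I Z Z Z, V Z Z I W U],
    [V I Z Z Z U, V Z I Z U W, V Z Z I W I], [V I Z Z W I, V Z I Z W W, V Z Z I Z I],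
    [V I Z Z I W, V Z I Z U I, V Z Z I W Z], [V I Z W Z I, V Z I U Z Z, V Z Z Z I U],
    [V I Z Z W U, V Z I Z I U, V Z Z I I U], [V I Z Z W W, V Z I Z U Z, V Z Z I W W],
    [V I Z Z W Z, V Z I Z Z W, V Z Z I U I], [V I Z Z I Z, V Z I Z U Z, V Z Z I I U],
    [V I Z Z Z I, V Z I W Z I, V Z Z Z I U], [V I Z Z Z U, V Z I Z Z U, V Z Z I W Z],
    [V I Z W Z W, V Z I W Z I, V Z Z Z I I], [V I Z Z W W, V Z I Z Z I, V Z Z I I U],
    [V I Z Z I U, V Z I Z Z W, V Z Z I W Z], [V I Z Z W I, V Z I Z I Z, V Z Z I Z U],
    [V I Z Z W W, V Z I Z I U, V Z Z I W U], [V I Z Z U I, V Z I Z Z W, V Z Z I I W],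
    [V I Z Z I W, V Z I Z W U, V Z Z I Z Z], [V I Z I Z W, V Z I W Z I, V Z Z Z I W],
    [V I Z Z I W, V Z I Z W W, V Z Z I I I], [V I Z Z W W, V Z I Z U I, V Z Z I Z W],
    [V I Z Z U W, V Z I Z Z W, V Z Z I U Z], [V I Z Z I Z, V Z I Z U I, V Z Z I Z U],
    [V I Z Z Z I, V Z I Z I U, V Z Z I W U], [V I Z Z I U, V Z I Z I U, V Z Z I W I],
    [V I Z I Z U, V Z I U Z I, V Z Z Z I I], [V I Z Z W I, V Z I Z Z I, V Z Z I W U],
    [V I Z Z U U, V Z I Z W W, V Z Z I Z W], [V I Z W Z Z, V Z I Z Z U, V Z Z Z I U],
    [V Z I Z U Z, V Z Z I U Z, V Z Z Z Z I], [V I Z Z W Z, V Z I Z W I, V Z Z I W Z],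
    [V I Z Z Z U, V Z I Z I U, V Z Z I I W], [V I Z Z I I, V Z I Z I W, V Z Z I I U],
    [V I Z Z W U, V Z I Z Z Z, V Z Z I Z I], [V I Z U Z I, V Z I I Z I, V Z Z Z I Z],
    [V I Z Z Z Z, V Z I Z W W, V Z Z I W U], [V I Z Z Z W, V Z I Z Z U, V Z Z I U I],
    [V I Z U Z U, V Z I U Z I, V Z Z Z I W], [V I Z Z I I, V Z I Z W U, V Z Z I U Z],
    [V I Z Z I U, V Z I Z Z Z, V Z Z I U I], [V I W Z Z I, V Z Z I Z W, V Z Z Z I Z],
    [V I Z Z Z Z, V Z I Z W Z, V Z Z I W W], [V I Z Z U Z, V Z I U I Z, V Z Z Z Z I],
    [V I Z Z Z W, V Z I Z W Z, V Z Z I I Z], [V I Z Z U Z, V Z I Z U W, V Z Z I I Z],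
    [V I Z Z Z W, V Z I Z U Z, V Z Z I I Z], [V I Z Z W Z, V Z I Z W W, V Z Z I I Z],
    [V I Z Z Z U, V Z I Z U I, V Z Z I I Z], [V I Z Z W U, V Z I Z W Z, V Z Z I I Z],
    [V I Z Z U Z, V Z I Z I U, V Z Z I I Z], [V I Z I Z Z, V Z I U Z W, V Z Z Z I U],
    [V I Z Z W I, V Z I Z I W, V Z Z I U Z], [V I Z Z U I, V Z I Z W U, V Z Z I Z W],
    [V I U Z Z Z, V Z Z I Z I, V Z Z Z I U], [V I Z W Z U, V Z I I Z U, V Z Z Z I W],
    [V I Z Z W I, V Z I Z U U, V Z Z I I U], [V I Z Z U W, V Z I Z W I, V Z Z I W I],
    [V I Z Z I Z, V Z I Z W I, V Z Z I W W], [V I Z Z Z I, V Z I Z I W, V Z Z I U Z],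
    [V I Z Z I W, V Z I Z I W, V Z Z I U U], [V I U Z Z I, V Z Z I Z U, V Z Z Z I I],
    [V I Z Z U I, V Z I Z Z I, V Z Z I Z W], [V I Z Z W W, V Z I Z U U, V Z Z I I W],
    [V I Z U Z W, V Z I Z Z W, V Z Z Z I W], [V I Z Z I U, V Z I Z U Z, V Z Z I U W],
    [V I Z Z W Z, V Z I Z I U, V Z Z I U U], [V I Z Z Z U, V Z I Z W U, V Z Z I Z W],
    [V I Z Z U U, V Z I Z U Z, V Z Z I W Z], [V I Z Z W Z, V Z I Z Z U, V Z Z I Z Z],
    [V I Z Z Z U, V Z I Z W W, V Z Z I I U], [V I Z Z U W, V Z I Z U I, V Z Z I I I],
    [V I Z Z I Z, V Z I Z W Z, V Z Z I W W], [V I Z Z Z I, V Z I U Z U, V Z Z Z I W],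
    [V I Z Z Z W, V Z I Z Z W, V Z Z I U U], [V I Z U Z W, V Z I U Z Z, V Z Z Z I I],
    [V I Z Z U U, V Z I Z Z I, V Z Z I Z U], [V I Z Z I W, V Z I Z Z U, V Z Z I U W],
    [V I Z Z U I, V Z I Z I Z, V Z Z I U W], [V I Z Z U U, V Z I Z W Z, V Z Z I I U],
    [V I Z Z U Z, V Z I Z Z U, V Z Z I U I], [V I Z Z Z W, V Z I Z W U, V Z Z I U U],
    [V I Z Z U I, V Z I Z U U, V Z Z I Z Z], [V I Z Z I U, V Z I Z W I, V Z Z I Z U],
    [V I W Z Z I, V Z Z I Z U, V Z Z Z I W], [V I Z Z U W, V Z I Z I W, V Z Z I U I],
    [V I Z Z I Z, V Z I Z I W, V Z Z I W U], [V I Z Z Z I, V Z I Z U U, V Z Z I U I],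
    [V I Z Z W I, V Z I Z W I, V Z Z I W U], [V I Z U Z I, V Z I W Z U, V Z Z Z I I],
    [V I Z W Z W, V Z I Z Z I, V Z Z Z I U], [V I Z Z U Z, V Z I Z W I, V Z Z I U U],
    [V I Z Z Z W, V Z I Z I Z, V Z Z I W I]]"

definition gens_c :: "matrix5 list" where
  "gens_c = [
    (V Z Z Z Z I, V Z Z Z I Z, V I Z I I Z, V I Z Z Z Z, V I I Z Z I, False)]"

definition perms_c :: "(nat list \<times> nat) list" where
  "perms_c = [
    ([1, 2, 3, 4, 5, 6, 0], 7)]"

definition quads_c :: "quad list list" where
  "quads_c = [
    [], [], [], [(3, 2, 0, 1)], [], [], []]"

definition frame_c :: "(nat \<times> nat \<times> nat) list" where
  "frame_c = [(0, 2, 6), (0, 2, 1), (1, 3, 6), (1, 2, 3), (2, 4, 0), (0, 3, 2)]"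

lemma c_valid: "valid 2 lines_c" "valid 3 planes_c"
  by code_simp+

lemma c_hyperplanes: "list_all (hyp_check lines_c planes_c) points"
  by code_simp

lemma c_points: "list_all (pt_check 7 (map ann lines_c) (map ann planes_c)) points"
  by code_simp

lemma c_upper:
  "upper_check 7 lines_c planes_c (ntab lines_c)
     (map (irow lines_c) (map ann planes_c)) (map ann lines_c) (map ann planes_c) quads_c frame_c 2 0 (V W W W I Z)"
  by code_simp

lemma c_gens: "gens_check lines_c planes_c gens_c perms_c"
  by code_simp

lemma c_prods:
  "distinct (map (take 1) (prods perms_c [0..<length lines_c]))"
  "length (prods perms_c [0..<length lines_c]) = 7"
  by code_simp+

lemma c_lengths: "length lines_c = 7" "length planes_c = 107"
  by code_simp+

theorem mainTheorem7:
  shows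
    "(\<exists>\<S> :: (gf4 ^ 5) set multiset.
        (\<forall>S\<in>#\<S>. vec.subspace S \<and> vec.dim S \<in> {2, 3}) \<and>
        size (filter_mset (\<lambda>S. vec.dim S = 2) \<S>) = 17 \<and>
        size (filter_mset (\<lambda>S. vec.dim S = 3) \<S>) = 65 \<and>
        (\<forall>H. hyperplane H \<longrightarrow> size (filter_mset (\<lambda>S. S \<subseteq> H) \<S>) = 2) \<and>
        multispread 51 5 3 \<S> \<and>
        order (aut_group \<S>) = 120) \<and>
     (\<exists>\<S> :: (gf4 ^ 5) set multiset.
        (\<forall>S\<in>#\<S>. vec.subspace S \<and> vec.dim S \<in> {2, 3}) \<and>
        size (filter_mset (\<lambda>S. vec.dim S = 2) \<S>) = 12 \<and>
        size (filter_mset (\<lambda>S. vec.dim S = 3) \<S>) = 86 \<and>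
        (\<forall>H. hyperplane H \<longrightarrow> size (filter_mset (\<lambda>S. S \<subseteq> H) \<S>) = 2) \<and>
        multispread 36 6 3 \<S> \<and>
        order (aut_group \<S>) = 40) \<and>
     (\<exists>\<S> :: (gf4 ^ 5) set multiset.
        (\<forall>S\<in>#\<S>. vec.subspace S \<and> vec.dim S \<in> {2, 3}) \<and>
        size (filter_mset (\<lambda>S. vec.dim S = 2) \<S>) = 7 \<and>
        size (filter_mset (\<lambda>S. vec.dim S = 3) \<S>) = 107 \<and>
        (\<forall>H. hyperplane H \<longrightarrow> size (filter_mset (\<lambda>S. S \<subseteq> H) \<S>) = 2) \<and>
        multispread 21 7 3 \<S> \<and>
        order (aut_group \<S>) = 7)"
  by (intro conjI realisation[OF a_valid a_hyperplanes a_points a_upper a_gens a_prods a_lengths]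
      realisation[OF b_valid b_hyperplanes b_points b_upper b_gens b_prods b_lengths]
      realisation[OF c_valid c_hyperplanes c_points c_upper c_gens c_prods c_lengths]) simp_all

end
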